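(* Fix a sufficiently small $\varepsilon>0$. Let $m,n\to\infty$ be integers with $n\le m=o(n^{1+\varepsilon})$, and let $\mathbf{s}=(s_1,\dots,s_m)$ and $\mathbf{t}=(t_1,\dots,t_n)$ be vectors of positive integers with $\sum_{i=1}^m s_i=\sum_{j=1}^n t_j$. Put $s=m^{-1}\sum_{i=1}^m s_i$ and $t=n^{-1}\sum_{j=1}^n t_j$, and suppose that $|s_i-s|=\mathcal{O}(n^{1/2+\varepsilon})$ uniformly for $1\le i\le m$ and $|t_j-t|=\mathcal{O}(m^{1/2+\varepsilon})$ uniformly for $1\le j\le n$. Let $\lambda=s/n=t/m$, and suppose $\lambda\le 1/2$ and $\lambda$ is bounded away from $0$. Suppose also that $$\frac{(1-2\lambda)^2}{4\lambda(1-\lambda)}\left(1+\frac{5m}{6n}+\frac{5n}{6m}\right)\le \frac{\log m}{3}.$$ Then almost all matrices in $\mathcal{A}(\mathbf{s},\mathbf{t})$ have no defining set of size less than $\lambda mn-\mathcal{O}(m^{7/4+\varepsilon})$.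
   Context: $\mathcal{A}(\mathbf{s},\mathbf{t})$ is the set of all $m\times n$ binary (0/1) matrices with exactly $s_i$ ones in row $i$ and $t_j$ ones in column $j$. "Almost all matrices in $\mathcal{A}(\mathbf{s},\mathbf{t})$ have a property" means the probability that a uniformly random element of $\mathcal{A}(\mathbf{s},\mathbf{t})$ has it tends to $1$ as $m,n\to\infty$. A partial binary matrix has entries in $\{0,1,\star\}$ ($\star$ = empty cell); $\mathcal{A}'(\mathbf{s},\mathbf{t})$ is the set of $m\times n$ partial binary matrices with at most $s_i$ ones and at most $n-s_i$ zeros in row $i$, and at most $t_j$ ones and at most $m-t_j$ zeros in column $j$. For $D\in\mathcal{A}'(\mathbf{s},\mathbf{t})$ and $M\in\mathcal{A}(\mathbf{s},\mathbf{t})$, write $D\subseteq M$ if $D_{ij}\in\{M_{ij},\star\}$ for all $i,j$. $D$ is a defining set for $M$ if $M$ is the unique member of $\mathcal{A}(\mathbf{s},\mathbf{t})$ with $D\subseteq M$. The size of $D$ is its number of non-empty cells. *)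

theory Defs
  imports "HOL-Probability.Probability" "Jordan_Normal_Form.Matrix"
begin

text \<open>Rows and columns are indexed from 0, as in the matrix library: a margin vector of
  length \<open>m\<close> is a function of which only the values below \<open>m\<close> matter.\<close>

definition binary_matrices ::
  "nat \<Rightarrow> nat \<Rightarrow> (nat \<Rightarrow> nat) \<Rightarrow> (nat \<Rightarrow> nat) \<Rightarrow> nat mat set" where
  "binary_matrices m n s t = {M \<in> carrier_mat m n.
     (\<forall>i<m. \<forall>j<n. M $$ (i, j) \<in> {0, 1}) \<and>
     (\<forall>i<m. card {j. j < n \<and> M $$ (i, j) = 1} = s i) \<and>
     (\<forall>j<n. card {i. i < m \<and> M $$ (i, j) = 1} = t j)}"

text \<open>\<open>None\<close> is the empty cell. The bounds on the numbers of zeros are written additively,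
  since natural subtraction would truncate when \<open>s i > n\<close> or \<open>t j > m\<close>.\<close>

definition partial_binary_matrices ::
  "nat \<Rightarrow> nat \<Rightarrow> (nat \<Rightarrow> nat) \<Rightarrow> (nat \<Rightarrow> nat) \<Rightarrow> nat option mat set" where
  "partial_binary_matrices m n s t = {D \<in> carrier_mat m n.
     (\<forall>i<m. \<forall>j<n. D $$ (i, j) \<in> {Some 0, Some 1, None}) \<and>
     (\<forall>i<m. card {j. j < n \<and> D $$ (i, j) = Some 1} \<le> s i \<and>
            card {j. j < n \<and> D $$ (i, j) = Some 0} + s i \<le> n) \<and>
     (\<forall>j<n. card {i. i < m \<and> D $$ (i, j) = Some 1} \<le> t j \<and>
            card {i. i < m \<and> D $$ (i, j) = Some 0} + t j \<le> m)}"

definition contained_in :: "nat option mat \<Rightarrow> nat mat \<Rightarrow> bool" where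
  "contained_in D M \<longleftrightarrow>
     (\<forall>i<dim_row M. \<forall>j<dim_col M. D $$ (i, j) \<in> {Some (M $$ (i, j)), None})"

definition defining_set ::
  "nat \<Rightarrow> nat \<Rightarrow> (nat \<Rightarrow> nat) \<Rightarrow> (nat \<Rightarrow> nat) \<Rightarrow> nat option mat \<Rightarrow> nat mat \<Rightarrow> bool" where
  "defining_set m n s t D M \<longleftrightarrow>
     D \<in> partial_binary_matrices m n s t \<and>
     M \<in> binary_matrices m n s t \<and> contained_in D M \<and>
     (\<forall>M' \<in> binary_matrices m n s t. contained_in D M' \<longrightarrow> M' = M)"

definition partial_size :: "nat option mat \<Rightarrow> nat" where
  "partial_size D = card {(i, j). i < dim_row D \<and> j < dim_col D \<and> D $$ (i, j) \<noteq> None}"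

definition average :: "nat \<Rightarrow> (nat \<Rightarrow> nat) \<Rightarrow> real" where
  "average m s = (\<Sum>i<m. real (s i)) / real m"

text \<open>This is also \<open>average n t / m\<close> when the row sums \<open>s\<close> and the column sums \<open>t\<close> have
  the same total.\<close>

definition ones_density :: "nat \<Rightarrow> nat \<Rightarrow> (nat \<Rightarrow> nat) \<Rightarrow> real" where
  "ones_density m n s = average m s / real n"

end

theory Submission
  imports Defs "HOL-Real_Asymp.Real_Asymp"
begin

text \<open>
  A matrix is represented by the set \<open>X\<close> of its cells containing a 1. Orient each empty cell of a
  defining set from its row to its column if it contains a 1 and backwards otherwise. A directed
  cycle could be flipped without changing the margins, so the orientation is acyclic, and
  a ranking \<open>\<rho>\<close> of rows and columns gives a region \<open>F\<close> containing all empty cells with a 1 and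
  none with a 0. A small defining set thus forces the ones of the matrix to outnumber the zeros in
  one of at most \<open>(m + n + 1) ^ (m + n)\<close> regions by at least \<open>C * m powr (7/4 + \<epsilon>)\<close>. Among all
  matrices with row sums \<open>s\<close> only a fraction \<open>exp (- C' * m powr (3/2 + 2 * \<epsilon>))\<close> has this property.

  No asymptotic enumeration is needed to condition on the column sums. Half of the matrices with row
  sums \<open>s\<close> have column sums that deviate from \<open>t\<close> by \<open>O(n * m powr (1/2 + \<epsilon>))\<close> in total, and each of
  them is turned into a member of \<open>\<A>(s, t)\<close> by changing that many cells. Hence \<open>\<A>(s, t)\<close> makes up
  a fraction of at least \<open>exp (- O(m powr (3/2 + 2 * \<epsilon>)))\<close>, with a constant independent of \<open>C\<close>.
\<close>

section \<open>Sampling without replacement\<close>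

text \<open>The quotient of the two binomials is the product of \<open>(s - i) / (n - i)\<close>
  over \<open>i < k\<close>, and each factor is at most \<open>s / n\<close>. Clearing denominators
  keeps the induction inside the naturals.\<close>

lemma binomial_diff_mult_power_le:
  fixes n s k :: nat
  assumes "k \<le> s" "s \<le> n"
  shows "((n - k) choose (s - k)) * n ^ k \<le> (n choose s) * s ^ k"
  using assms(1)
proof (induction k)
  case (Suc k)
  have e1: "n - k = Suc (n - Suc k)" "s - k = Suc (s - Suc k)"
    using Suc.prems assms by auto
  have abs: "((n - Suc k) choose (s - Suc k)) * (n - k) = ((n - k) choose (s - k)) * (s - k)"
    using Suc_times_binomial_eq[of "n - Suc k" "s - Suc k"] unfolding e1[symmetric]
    by (simp add: mult.commute)
  have le: "(s - k) * n \<le> s * (n - k)"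
    using Suc.prems assms by (simp add: diff_mult_distrib diff_mult_distrib2 diff_le_mono2)
  have "((n - Suc k) choose (s - Suc k)) * n ^ Suc k * (n - k)
      = ((n - k) choose (s - k)) * n ^ k * ((s - k) * n)"
    using arg_cong[OF abs, of "\<lambda>x. x * (n ^ k * n)"] by (simp only: mult_ac power_Suc)
  also have "\<dots> \<le> ((n choose s) * s ^ k) * (s * (n - k))"
    by (intro mult_le_mono le Suc.IH) (use Suc.prems in auto)
  also have "\<dots> = (n choose s) * s ^ Suc k * (n - k)"
    by simp
  finally show ?case
    using Suc.prems assms by simp
qed simp

lemma card_subsets_superset:
  assumes "finite A" "K \<subseteq> A" "card K \<le> s"
  shows "card {S. S \<subseteq> A \<and> card S = s \<and> K \<subseteq> S} = (card A - card K) choose (s - card K)"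
proof -
  have finK: "finite K"
    using assms finite_subset by auto
  have "bij_betw (\<lambda>S. S \<union> K) {S. S \<subseteq> A - K \<and> card S = s - card K}
     {S. S \<subseteq> A \<and> card S = s \<and> K \<subseteq> S}"
  proof (rule bij_betw_byWitness[where f' = "\<lambda>S. S - K"])
    show "(\<lambda>S. S \<union> K) ` {S. S \<subseteq> A - K \<and> card S = s - card K} \<subseteq>
        {S. S \<subseteq> A \<and> card S = s \<and> K \<subseteq> S}"
    proof clarsimp
      fix S assume S: "S \<subseteq> A - K" "card S = s - card K"
      have "card (S \<union> K) = card S + card K"
        by (rule card_Un_disjoint) (use S finK assms in \<open>auto dest: finite_subset[of S]\<close>)
      thus "S \<subseteq> A \<and> K \<subseteq> A \<and> card (S \<union> K) = s"
        using S assms by auto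
    qed
    show "(\<lambda>S. S - K) ` {S. S \<subseteq> A \<and> card S = s \<and> K \<subseteq> S} \<subseteq>
        {S. S \<subseteq> A - K \<and> card S = s - card K}"
      using finK by (auto simp: card_Diff_subset)
  qed auto
  from bij_betw_same_card[OF this] have
    "card {S. S \<subseteq> A \<and> card S = s \<and> K \<subseteq> S} = card {S. S \<subseteq> A - K \<and> card S = s - card K}"
    by simp
  also have "\<dots> = card (A - K) choose (s - card K)"
    using assms by (simp add: n_subsets)
  finally show ?thesis
    using assms finK by (simp add: card_Diff_subset)
qed

text \<open>A uniformly random subset of size \<open>s\<close> contains \<open>K\<close> with at
  most the probability that independent sampling at rate \<open>s / card A\<close> would
  give.\<close>

lemma card_subsets_superset_le:
  assumes "finite A" "K \<subseteq> A" "s \<le> card A"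
  shows "real (card {S. S \<subseteq> A \<and> card S = s \<and> K \<subseteq> S})
    \<le> real (card A choose s) * (real s / real (card A)) ^ card K"
proof (cases "card K \<le> s")
  case True
  show ?thesis
  proof (cases "card A = 0")
    case True
    hence "{S. S \<subseteq> A \<and> card S = s \<and> K \<subseteq> S} = {{}}"
      using assms by auto
    thus ?thesis using True assms by simp
  next
    case False
    have "real (((card A - card K) choose (s - card K)) * card A ^ card K)
        \<le> real ((card A choose s) * s ^ card K)"
      using binomial_diff_mult_power_le[OF True assms(3)] by (rule of_nat_mono)
    thus ?thesis
      using False True assms
      by (simp add: card_subsets_superset power_divide pos_le_divide_eq card_gt_0_iff)
  qed
next
  case False
  hence eq: "{S. S \<subseteq> A \<and> card S = s \<and> K \<subseteq> S} = {}"
    using assms(1) by (auto dest: card_mono finite_subset)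
  show ?thesis unfolding eq by simp
qed

lemma sum_power_card_Pow:
  fixes x :: "'a :: comm_semiring_1"
  assumes "finite A"
  shows "(\<Sum>K\<in>Pow A. x ^ card K) = (1 + x) ^ card A"
  using prod_add[OF assms, of "\<lambda>_. x" "\<lambda>_. 1"] by (simp add: add.commute)

text \<open>Sampling without replacement: expanding \<open>(1 + x) ^ card (S \<inter> F)\<close> over the subsets of
  \<open>S \<inter> F\<close> gives the bound with the generating function of the binomial distribution.\<close>

lemma sum_subsets_power_card_Int_le:
  fixes x :: real
  assumes "finite A" "F \<subseteq> A" "s \<le> card A" "0 \<le> x"
  shows "(\<Sum>S | S \<subseteq> A \<and> card S = s. (1 + x) ^ card (S \<inter> F))
    \<le> real (card A choose s) * (1 + x * (real s / real (card A))) ^ card F"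
proof -
  let ?q = "real s / real (card A)"
  have finF: "finite F"
    using assms finite_subset by auto
  have "(\<Sum>S | S \<subseteq> A \<and> card S = s. (1 + x) ^ card (S \<inter> F))
      = (\<Sum>S | S \<subseteq> A \<and> card S = s. \<Sum>K | K \<in> Pow F \<and> K \<subseteq> S. x ^ card K)"
  proof (rule sum.cong[OF refl])
    fix S assume "S \<in> {S. S \<subseteq> A \<and> card S = s}"
    have eq: "{K. K \<in> Pow F \<and> K \<subseteq> S} = Pow (S \<inter> F)"
      by auto
    show "(1 + x) ^ card (S \<inter> F) = (\<Sum>K | K \<in> Pow F \<and> K \<subseteq> S. x ^ card K)"
      unfolding eq using finF by (subst sum_power_card_Pow) auto
  qed
  also have "\<dots> = (\<Sum>K\<in>Pow F. \<Sum>S | S \<in> {S. S \<subseteq> A \<and> card S = s} \<and> K \<subseteq> S. x ^ card K)"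
    by (rule sum.swap_restrict) (use assms finF in auto)
  also have "\<dots> = (\<Sum>K\<in>Pow F. x ^ card K * real (card {S. S \<subseteq> A \<and> card S = s \<and> K \<subseteq> S}))"
    by (simp add: conj_assoc mult.commute)
  also have "\<dots> \<le> (\<Sum>K\<in>Pow F. x ^ card K * (real (card A choose s) * ?q ^ card K))"
    by (intro sum_mono mult_left_mono card_subsets_superset_le) (use assms in auto)
  also have "\<dots> = real (card A choose s) * (\<Sum>K\<in>Pow F. (x * ?q) ^ card K)"
    by (simp only: sum_distrib_left power_mult_distrib mult_ac)
  also have "\<dots> = real (card A choose s) * (1 + x * ?q) ^ card F"
    using finF by (simp add: sum_power_card_Pow)
  finally show ?thesis .
qed

section \<open>Upper tails for matrices with prescribed row sums\<close>

definition row_margin_sets :: "nat \<Rightarrow> nat \<Rightarrow> (nat \<Rightarrow> nat) \<Rightarrow> (nat \<times> nat) set set" where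
  "row_margin_sets m n s = {X. X \<subseteq> {..<m} \<times> {..<n} \<and> (\<forall>i<m. card {j. (i, j) \<in> X} = s i)}"

lemma finite_row_margin_sets [simp]: "finite (row_margin_sets m n s)"
  by (rule finite_subset[of _ "Pow ({..<m} \<times> {..<n})"]) (auto simp: row_margin_sets_def)

text \<open>The rows can be chosen independently of each other, so sums of row-wise products
  factorise. Taking \<open>h\<close> constantly 1 counts the sets; taking powers gives a moment
  generating function.\<close>

lemma sum_row_margin_sets_prod:
  fixes h :: "nat \<Rightarrow> nat set \<Rightarrow> 'a :: comm_semiring_1"
  shows "(\<Sum>X\<in>row_margin_sets m n s. \<Prod>i<m. h i {j. (i, j) \<in> X})
    = (\<Prod>i<m. \<Sum>S | S \<subseteq> {..<n} \<and> card S = s i. h i S)"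
proof -
  have "(\<Prod>i<m. \<Sum>S | S \<subseteq> {..<n} \<and> card S = s i. h i S)
      = (\<Sum>g\<in>PiE {..<m} (\<lambda>i. {S. S \<subseteq> {..<n} \<and> card S = s i}). \<Prod>i<m. h i (g i))"
    by (rule prod_sum_PiE) auto
  also have "\<dots> = (\<Sum>X\<in>row_margin_sets m n s. \<Prod>i<m. h i {j. (i, j) \<in> X})"
  proof (rule sum.reindex_bij_witness[where i = "\<lambda>X. \<lambda>i\<in>{..<m}. {j. (i, j) \<in> X}"
        and j = "\<lambda>g. Sigma {..<m} g"])
    fix g assume g: "g \<in> PiE {..<m} (\<lambda>i. {S. S \<subseteq> {..<n} \<and> card S = s i})"
    have row: "{j. (i, j) \<in> Sigma {..<m} g} = g i" if "i < m" for i
      using that by auto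
    show "(\<lambda>i\<in>{..<m}. {j. (i, j) \<in> Sigma {..<m} g}) = g"
      using g by (intro ext) (auto simp: PiE_def extensional_def)
    show "Sigma {..<m} g \<in> row_margin_sets m n s"
      using g unfolding row_margin_sets_def
      by (auto simp: PiE_def Pi_def)
    show "(\<Prod>i<m. h i {j. (i, j) \<in> Sigma {..<m} g}) = (\<Prod>i<m. h i (g i))"
      by (intro prod.cong refl) (simp add: row)
  next
    fix X assume "X \<in> row_margin_sets m n s"
    thus "Sigma {..<m} (\<lambda>i\<in>{..<m}. {j. (i, j) \<in> X}) = X"
      "(\<lambda>i\<in>{..<m}. {j. (i, j) \<in> X}) \<in> PiE {..<m} (\<lambda>i. {S. S \<subseteq> {..<n} \<and> card S = s i})"
      by (auto simp: row_margin_sets_def)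
  qed
  finally show ?thesis ..
qed

lemma card_row_margin_sets: "card (row_margin_sets m n s) = (\<Prod>i<m. n choose s i)"
  using sum_row_margin_sets_prod[of "\<lambda>_ _. 1 :: nat" m n s] by (simp add: n_subsets)

lemma card_eq_sum_card_rows:
  assumes "X \<subseteq> {..<m :: nat} \<times> {..<n :: nat}"
  shows "card X = (\<Sum>i<m. card {j. (i, j) \<in> X})"
proof -
  have eq: "X = Sigma {..<m} (\<lambda>i. {j. (i, j) \<in> X})"
    using assms by auto
  have "finite {j. (i, j) \<in> X}" for i
    by (rule finite_subset[of _ "{..<n}"]) (use assms in auto)
  thus ?thesis
    by (subst eq, subst card_SigmaI) auto
qed

text \<open>By independence of the rows the bound for a single row multiplies up, and
  \<open>1 + u \<le> exp u\<close> collects the factors into one exponential of the mean number of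
  ones in \<open>F\<close>.\<close>

lemma sum_row_margin_sets_power_card_Int_le:
  fixes x :: real
  assumes "F \<subseteq> {..<m} \<times> {..<n}" "\<And>i. i < m \<Longrightarrow> s i \<le> n" "0 \<le> x"
  shows "(\<Sum>X\<in>row_margin_sets m n s. (1 + x) ^ card (X \<inter> F))
    \<le> real (card (row_margin_sets m n s)) * exp (x * (\<Sum>(i, j)\<in>F. real (s i) / real n))"
proof -
  define G where "G i = {j. (i, j) \<in> F}" for i
  have G: "G i \<subseteq> {..<n}" and finG: "finite (G i)" for i
    using assms(1) finite_subset[of "G i" "{..<n}"] by (auto simp: G_def)
  have "(1 + x) ^ card (X \<inter> F) = (\<Prod>i<m. (1 + x) ^ card ({j. (i, j) \<in> X} \<inter> G i))" for X
  proof -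
    have "X \<inter> F \<subseteq> {..<m} \<times> {..<n}"
      using assms(1) by auto
    from card_eq_sum_card_rows[OF this] show ?thesis
      by (simp add: power_sum G_def Collect_conj_eq)
  qed
  hence "(\<Sum>X\<in>row_margin_sets m n s. (1 + x) ^ card (X \<inter> F))
      = (\<Prod>i<m. \<Sum>S | S \<subseteq> {..<n} \<and> card S = s i. (1 + x) ^ card (S \<inter> G i))"
    by (simp only: sum_row_margin_sets_prod[of "\<lambda>i S. (1 + x) ^ card (S \<inter> G i)"])
  also have "\<dots> \<le> (\<Prod>i<m. real (n choose s i) * exp (x * (real (card (G i)) * (real (s i) / real n))))"
  proof (intro prod_mono conjI)
    fix i assume i: "i \<in> {..<m}"
    show "0 \<le> (\<Sum>S | S \<subseteq> {..<n} \<and> card S = s i. (1 + x) ^ card (S \<inter> G i))"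
      using assms by (intro sum_nonneg) auto
    have "(\<Sum>S | S \<subseteq> {..<n} \<and> card S = s i. (1 + x) ^ card (S \<inter> G i))
        \<le> real (n choose s i) * (1 + x * (real (s i) / real n)) ^ card (G i)"
      using sum_subsets_power_card_Int_le[of "{..<n}" "G i" "s i" x] G i assms by simp
    also have "\<dots> \<le> real (n choose s i) * exp (x * (real (s i) / real n)) ^ card (G i)"
      using assms by (intro mult_left_mono power_mono exp_ge_add_one_self) auto
    finally show "(\<Sum>S | S \<subseteq> {..<n} \<and> card S = s i. (1 + x) ^ card (S \<inter> G i))
        \<le> real (n choose s i) * exp (x * (real (card (G i)) * (real (s i) / real n)))"
      by (simp only: exp_of_nat_mult mult.left_commute[of x])
  qed
  also have "\<dots> = real (card (row_margin_sets m n s)) * exp (x * (\<Sum>i<m. \<Sum>j\<in>G i. real (s i) / real n))"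
    by (simp add: card_row_margin_sets prod.distrib exp_sum sum_distrib_left)
  also have "(\<Sum>i<m. \<Sum>j\<in>G i. real (s i) / real n) = (\<Sum>(i, j)\<in>Sigma {..<m} G. real (s i) / real n)"
    by (rule sum.Sigma) (auto simp: finG)
  also have "Sigma {..<m} G = F"
    using assms(1) by (auto simp: G_def)
  finally show ?thesis .
qed

text \<open>Chernoff's bound: Markov's inequality for
  \<open>exp (\<theta> * card (X \<inter> F))\<close>, with \<open>1 + x = exp \<theta>\<close> in
  the generating function and \<open>exp \<theta> - 1 \<le> \<theta> + \<theta>\<^sup>2\<close> on
  the unit interval.\<close>

lemma card_row_margin_sets_tail:
  fixes \<theta> T :: real
  assumes "F \<subseteq> {..<m} \<times> {..<n}" "\<And>i. i < m \<Longrightarrow> s i \<le> n" "0 \<le> \<theta>" "\<theta> \<le> 1"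
  shows "real (card {X \<in> row_margin_sets m n s. T \<le> real (card (X \<inter> F))})
    \<le> real (card (row_margin_sets m n s)) *
        exp ((\<theta> + \<theta>\<^sup>2) * (\<Sum>(i, j)\<in>F. real (s i) / real n) - \<theta> * T)"
proof -
  let ?R = "row_margin_sets m n s" and ?p = "\<Sum>(i, j)\<in>F. real (s i) / real n"
  let ?B = "{X \<in> ?R. T \<le> real (card (X \<inter> F))}"
  have pow: "(1 + (exp \<theta> - 1)) ^ k = exp (\<theta> * real k)" for k
    by (simp add: exp_of_nat2_mult)
  have p: "0 \<le> ?p"
    by (intro sum_nonneg) auto
  have "real (card ?B) * exp (\<theta> * T) = (\<Sum>X\<in>?B. exp (\<theta> * T))"
    by simp
  also have "\<dots> \<le> (\<Sum>X\<in>?B. exp (\<theta> * real (card (X \<inter> F))))"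
    using assms by (intro sum_mono) (auto intro: mult_left_mono)
  also have "\<dots> \<le> (\<Sum>X\<in>?R. exp (\<theta> * real (card (X \<inter> F))))"
    by (intro sum_mono2) auto
  also have "\<dots> \<le> real (card ?R) * exp ((exp \<theta> - 1) * ?p)"
    using sum_row_margin_sets_power_card_Int_le[OF assms(1), of s "exp \<theta> - 1"] assms
    unfolding pow by simp
  also have "\<dots> \<le> real (card ?R) * exp ((\<theta> + \<theta>\<^sup>2) * ?p)"
    using exp_bound[OF assms(3,4)] p by (intro mult_left_mono) (auto intro: mult_right_mono)
  finally show ?thesis
    by (simp add: exp_diff pos_le_divide_eq)
qed

section \<open>Repairing the column sums\<close>

definition margin_sets :: "nat \<Rightarrow> nat \<Rightarrow> (nat \<Rightarrow> nat) \<Rightarrow> (nat \<Rightarrow> nat) \<Rightarrow> (nat \<times> nat) set set" where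
  "margin_sets m n s t = {X \<in> row_margin_sets m n s. \<forall>j<n. card {i. (i, j) \<in> X} = t j}"

lemma finite_margin_sets [simp]: "finite (margin_sets m n s t)"
  by (simp add: margin_sets_def)

lemma row_margin_setsD:
  assumes "X \<in> row_margin_sets m n s"
  shows "X \<subseteq> {..<m} \<times> {..<n}" "finite X" "finite {j. (i, j) \<in> X}" "finite {i. (i, j) \<in> X}"
    "i < m \<Longrightarrow> card {j. (i, j) \<in> X} = s i"
proof -
  show sub: "X \<subseteq> {..<m} \<times> {..<n}"
    using assms by (auto simp: row_margin_sets_def)
  show "finite X"
    using sub by (rule finite_subset) auto
  show "finite {j. (i, j) \<in> X}" "finite {i. (i, j) \<in> X}"
    by (rule finite_subset[of _ "{..<n}"], use sub in auto,
        rule finite_subset[of _ "{..<m}"], use sub in auto)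
  show "i < m \<Longrightarrow> card {j. (i, j) \<in> X} = s i"
    using assms by (auto simp: row_margin_sets_def)
qed

lemma card_eq_sum_card_cols:
  assumes "X \<subseteq> {..<m :: nat} \<times> {..<n :: nat}"
  shows "card X = (\<Sum>j<n. card {i. (i, j) \<in> X})"
  using card_eq_sum_card_rows[of "X\<inverse>" n m] assms by auto

lemma swap_in_row:
  fixes X :: "(nat \<times> nat) set"
  assumes X: "X \<in> row_margin_sets m n s" and i: "i < m" "(i, j) \<in> X" "(i, j') \<notin> X" "j' < n"
  shows "\<exists>Y \<in> row_margin_sets m n s. Y = insert (i, j') (X - {(i, j)}) \<and>
    card {k. (k, j) \<in> X} = Suc (card {k. (k, j) \<in> Y}) \<and>
    card {k. (k, j') \<in> Y} = Suc (card {k. (k, j') \<in> X}) \<and>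
    (\<forall>l. l \<noteq> j \<and> l \<noteq> j' \<longrightarrow> card {k. (k, l) \<in> Y} = card {k. (k, l) \<in> X}) \<and>
    card (sym_diff X Y) \<le> 2"
proof -
  define Y where "Y = insert (i, j') (X - {(i, j)})"
  have ne: "j \<noteq> j'"
    using i by auto
  have rows: "{l. (k, l) \<in> Y} = (if k = i then insert j' ({l. (k, l) \<in> X} - {j}) else {l. (k, l) \<in> X})" for k
    using ne by (auto simp: Y_def)
  have "card {l. (k, l) \<in> Y} = s k" if "k < m" for k
  proof (cases "k = i")
    case True
    have "card {l. (i, l) \<in> Y} = Suc (card ({l. (i, l) \<in> X} - {j}))"
      using i row_margin_setsD(3)[OF X] by (simp add: rows)
    also have "\<dots> = card {l. (i, l) \<in> X}"
      by (rule card_Suc_Diff1) (use i row_margin_setsD(3)[OF X] in auto)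
    finally show ?thesis
      using row_margin_setsD(5)[OF X] that True by simp
  next
    case False
    thus ?thesis
      using row_margin_setsD(5)[OF X] that by (simp add: rows)
  qed
  hence "Y \<in> row_margin_sets m n s"
    using row_margin_setsD(1)[OF X] i by (auto simp: row_margin_sets_def Y_def)
  moreover have "{k. (k, j) \<in> Y} = {k. (k, j) \<in> X} - {i}"
    using ne by (auto simp: Y_def)
  hence "card {k. (k, j) \<in> X} = Suc (card {k. (k, j) \<in> Y})"
    using card_Suc_Diff1[of "{k. (k, j) \<in> X}" i] row_margin_setsD(4)[OF X] i by simp
  moreover have "{k. (k, j') \<in> Y} = insert i {k. (k, j') \<in> X}"
    using ne by (auto simp: Y_def)
  hence "card {k. (k, j') \<in> Y} = Suc (card {k. (k, j') \<in> X})"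
    using row_margin_setsD(4)[OF X] i by simp
  moreover have "{k. (k, l) \<in> Y} = {k. (k, l) \<in> X}" if "l \<noteq> j" "l \<noteq> j'" for l
    using that by (auto simp: Y_def)
  moreover have "card (sym_diff X Y) \<le> card {(i, j), (i, j')}"
    by (rule card_mono) (auto simp: Y_def)
  hence "card (sym_diff X Y) \<le> 2"
    by (rule order_trans) (auto simp: card_insert_if)
  ultimately show ?thesis
    unfolding Y_def[symmetric] by auto
qed

lemma card_sym_diff_triangle:
  assumes "finite X" "finite Y" "finite Z"
  shows "card (sym_diff X Z) \<le> card (sym_diff X Y) + card (sym_diff Y Z)"
proof -
  have "card (sym_diff X Z) \<le> card (sym_diff X Y \<union> sym_diff Y Z)"
    by (rule card_mono) (use assms in auto)
  also have "\<dots> \<le> card (sym_diff X Y) + card (sym_diff Y Z)"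
    by (rule card_Un_le)
  finally show ?thesis .
qed

text \<open>If neither a direct swap nor one through a third column exists, all columns are nested
  with column \<open>j\<close> or \<open>j'\<close>, so that the rows meeting column \<open>j'\<close> are too heavy.\<close>

lemma move_between_columns:
  fixes X :: "(nat \<times> nat) set" and a a' b :: real
  assumes X: "X \<in> row_margin_sets m n s"
    and j: "j < n" "t j < card {i. (i, j) \<in> X}"
    and j': "j' < n" "card {i. (i, j') \<in> X} < t j'"
    and a: "\<And>l. l < n \<Longrightarrow> a \<le> real (t l)" "\<And>l. l < n \<Longrightarrow> real (t l) \<le> a'"
    and b: "\<And>i. i < m \<Longrightarrow> real (s i) \<le> b" "0 \<le> b"
    and L: "a' * b + (\<Sum>l<n. \<bar>real (card {i. (i, l) \<in> X}) - real (t l)\<bar>) < real n * a"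
  shows "\<exists>Y \<in> row_margin_sets m n s.
    card {k. (k, j) \<in> X} = Suc (card {k. (k, j) \<in> Y}) \<and>
    card {k. (k, j') \<in> Y} = Suc (card {k. (k, j') \<in> X}) \<and>
    (\<forall>l. l \<noteq> j \<and> l \<noteq> j' \<longrightarrow> card {k. (k, l) \<in> Y} = card {k. (k, l) \<in> X}) \<and>
    card (sym_diff X Y) \<le> 4"
proof (cases "\<exists>i. (i, j) \<in> X \<and> (i, j') \<notin> X")
  case True
  then obtain i where i: "(i, j) \<in> X" "(i, j') \<notin> X" by auto
  hence "i < m"
    using row_margin_setsD(1)[OF X] by auto
  from swap_in_row[OF X this i j'(1)] show ?thesis
    by (elim bexE) (rule bexI, auto)
next
  case direct: False
  define P where "P l = {i. (i, l) \<in> X}" for l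
  have finP: "finite (P l)" for l
    using row_margin_setsD(4)[OF X] by (simp add: P_def)
  have "\<exists>l<n. \<exists>i i'. (i, j) \<in> X \<and> (i, l) \<notin> X \<and> (i', l) \<in> X \<and> (i', j') \<notin> X"
  proof (rule ccontr)
    assume no: "\<not> ?thesis"
    have jj': "P j \<subseteq> P j'"
      using direct by (auto simp: P_def)
    have nested: "P j \<subseteq> P l \<or> P l \<subseteq> P j'" if "l < n" for l
      using no that by (auto simp: P_def)
    \<comment> \<open>Up to its own deviation, every column has at least \<open>a\<close> ones in
      the rows that meet column \<open>j'\<close>. If \<open>P j\<close> lies in \<open>P l\<close>,
      the overfull column \<open>j\<close> already supplies them; otherwise all of column
      \<open>l\<close> lies in those rows.\<close>
    have "a - \<bar>real (card (P l)) - real (t l)\<bar> \<le> real (card (P l \<inter> P j'))" if l: "l < n" for l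
      using nested[OF l]
    proof
      assume "P j \<subseteq> P l"
      hence "card (P j) \<le> card (P l \<inter> P j')"
        using jj' finP by (intro card_mono) auto
      thus ?thesis
        using j a(1)[of j] by (simp add: P_def)
    next
      assume "P l \<subseteq> P j'"
      hence "P l \<inter> P j' = P l" by auto
      thus ?thesis
        using a(1)[OF l] by simp
    qed
    hence "(\<Sum>l<n. a - \<bar>real (card (P l)) - real (t l)\<bar>) \<le> (\<Sum>l<n. real (card (P l \<inter> P j')))"
      by (intro sum_mono) auto
    \<comment> \<open>The ones in these rows are now counted by rows instead: there are at most
      \<open>a'\<close> rows with at most \<open>b\<close> ones each, which contradicts
      \<open>L\<close>.\<close>
    also have "\<dots> = real (card (X \<inter> (P j' \<times> UNIV)))"
    proof -
      have "X \<inter> (P j' \<times> UNIV) \<subseteq> {..<m} \<times> {..<n}"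
        using row_margin_setsD(1)[OF X] by auto
      from card_eq_sum_card_cols[OF this] show ?thesis
        by (simp add: P_def Collect_conj_eq)
    qed
    also have "X \<inter> (P j' \<times> UNIV) = Sigma (P j') (\<lambda>i. {l. (i, l) \<in> X})"
      by auto
    also have "real (card \<dots>) = (\<Sum>i\<in>P j'. real (card {l. (i, l) \<in> X}))"
      using finP row_margin_setsD(3)[OF X] by (simp add: card_SigmaI)
    also have "\<dots> \<le> (\<Sum>i\<in>P j'. b)"
    proof (rule sum_mono)
      fix i assume "i \<in> P j'"
      hence "i < m"
        using row_margin_setsD(1)[OF X] by (auto simp: P_def)
      thus "real (card {l. (i, l) \<in> X}) \<le> b"
        using b row_margin_setsD(5)[OF X] by simp
    qed
    also have "\<dots> = real (card (P j')) * b"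
      by simp
    also have "\<dots> \<le> a' * b"
      using j' a(2)[OF j'(1)] b(2) by (intro mult_right_mono) (auto simp: P_def)
    finally show False
      using L by (simp add: sum_subtractf P_def)
  qed
  then obtain l i i' where l: "l < n" "(i, j) \<in> X" "(i, l) \<notin> X" "(i', l) \<in> X" "(i', j') \<notin> X"
    by auto
  have im: "i < m" "i' < m"
    using l row_margin_setsD(1)[OF X] by auto
  have ne: "i \<noteq> i'" "l \<noteq> j" "l \<noteq> j'" "j \<noteq> j'"
    using l direct j j' by auto
  \<comment> \<open>A one moves from \<open>j\<close> to \<open>l\<close> in row \<open>i\<close>,
    then another from \<open>l\<close> to \<open>j'\<close> in row \<open>i'\<close>, so column
    \<open>l\<close> recovers its sum. As \<open>l\<close> differs from \<open>j\<close> and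
    \<open>j'\<close>, the first swap leaves the cells of the second as they were.\<close>
  obtain Z where Z: "Z \<in> row_margin_sets m n s" "Z = insert (i, l) (X - {(i, j)})"
    "card {k. (k, j) \<in> X} = Suc (card {k. (k, j) \<in> Z})"
    "card {k. (k, l) \<in> Z} = Suc (card {k. (k, l) \<in> X})"
    "\<forall>q. q \<noteq> j \<and> q \<noteq> l \<longrightarrow> card {k. (k, q) \<in> Z} = card {k. (k, q) \<in> X}"
    "card (sym_diff X Z) \<le> 2"
    using swap_in_row[OF X im(1) l(2,3,1)] by blast
  have "(i', l) \<in> Z" "(i', j') \<notin> Z"
    using l ne Z(2) by auto
  then obtain Y where Y: "Y \<in> row_margin_sets m n s"
    "card {k. (k, l) \<in> Z} = Suc (card {k. (k, l) \<in> Y})"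
    "card {k. (k, j') \<in> Y} = Suc (card {k. (k, j') \<in> Z})"
    "\<forall>q. q \<noteq> l \<and> q \<noteq> j' \<longrightarrow> card {k. (k, q) \<in> Y} = card {k. (k, q) \<in> Z}"
    "card (sym_diff Z Y) \<le> 2"
    using swap_in_row[OF Z(1) im(2) _ _ j'(1)] by blast
  have "card (sym_diff X Y) \<le> 4"
    using card_sym_diff_triangle[of X Z Y] Z Y X row_margin_setsD(2) by fastforce
  moreover have "card {k. (k, q) \<in> Y} = card {k. (k, q) \<in> X}" if "q \<noteq> j" "q \<noteq> j'" for q
    using that Y(2,4) Z(4,5) by (cases "q = l") auto
  ultimately show ?thesis
    using Y Z ne by (intro bexI[of _ Y]) auto
qed

lemma sum_pos_neg_exist:
  fixes f :: "'a \<Rightarrow> int"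
  assumes "finite A" "(\<Sum>x\<in>A. f x) = 0" "(\<Sum>x\<in>A. \<bar>f x\<bar>) \<noteq> 0"
  shows "(\<exists>x\<in>A. 0 < f x) \<and> (\<exists>x\<in>A. f x < 0)"
proof -
  have *: "\<exists>x\<in>A. 0 < g x" if "(\<Sum>x\<in>A. g x) = 0" "(\<Sum>x\<in>A. \<bar>g x\<bar>) \<noteq> 0" for g :: "'a \<Rightarrow> int"
  proof (rule ccontr)
    assume "\<not> (\<exists>x\<in>A. 0 < g x)"
    hence "(\<Sum>x\<in>A. \<bar>g x\<bar>) = (\<Sum>x\<in>A. - g x)"
      by (intro sum.cong) force+
    thus False
      using that by (simp add: sum_negf)
  qed
  show ?thesis
    using *[of f] *[of "\<lambda>x. - f x"] assms by (auto simp: sum_negf)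
qed

text \<open>As the totals agree, a column that is too full comes with one that is too empty. Each
  move lowers the total deviation by 2 and changes at most 4 cells, so twice the initial deviation
  bounds the distance. The deviation only decreases, hence the condition \<open>L\<close> stays
  available for the next move.\<close>

lemma repair_columns:
  fixes X :: "(nat \<times> nat) set" and a a' b L :: real
  assumes "X \<in> row_margin_sets m n s"
    and st: "(\<Sum>i<m. s i) = (\<Sum>j<n. t j)"
    and a: "\<And>l. l < n \<Longrightarrow> a \<le> real (t l)" "\<And>l. l < n \<Longrightarrow> real (t l) \<le> a'"
    and b: "\<And>i. i < m \<Longrightarrow> real (s i) \<le> b" "0 \<le> b"
    and "(\<Sum>l<n. \<bar>real (card {i. (i, l) \<in> X}) - real (t l)\<bar>) \<le> L"
    and L: "a' * b + L < real n * a"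
  shows "\<exists>Y \<in> margin_sets m n s t. real (card (sym_diff X Y)) \<le> 2 * L"
proof -
  define dev :: "(nat \<times> nat) set \<Rightarrow> int" where
    "dev X = (\<Sum>l<n. \<bar>int (card {i. (i, l) \<in> X}) - int (t l)\<bar>)" for X
  have dev_real: "real_of_int (dev X) = (\<Sum>l<n. \<bar>real (card {i. (i, l) \<in> X}) - real (t l)\<bar>)" for X
    by (simp add: dev_def)
  have dev_nonneg: "0 \<le> dev X" for X
    by (simp add: dev_def sum_nonneg)
  have "X \<in> row_margin_sets m n s \<Longrightarrow> dev X \<le> L \<Longrightarrow>
    \<exists>Y \<in> margin_sets m n s t. int (card (sym_diff X Y)) \<le> 2 * dev X" for X
  proof (induction "nat (dev X)" arbitrary: X rule: less_induct)
    case less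
    note X = less.prems(1)
    show ?case
    proof (cases "dev X = 0")
      case True
      hence "X \<in> margin_sets m n s t"
        using X by (auto simp: margin_sets_def dev_def sum_nonneg_eq_0_iff)
      thus ?thesis
        using True by (intro bexI[of _ X]) auto
    next
      case False
      define f where "f l = int (card {i. (i, l) \<in> X}) - int (t l)" for l
      have "(\<Sum>l<n. card {i. (i, l) \<in> X}) = (\<Sum>l<n. t l)"
        using card_eq_sum_card_cols[OF row_margin_setsD(1)[OF X]]
          card_eq_sum_card_rows[OF row_margin_setsD(1)[OF X]] row_margin_setsD(5)[OF X] st
        by simp
      hence "(\<Sum>l<n. f l) = 0"
        unfolding f_def sum_subtractf by (simp flip: of_nat_sum)
      then obtain j j' where j: "j < n" "f j > 0" "j' < n" "f j' < 0"
        using sum_pos_neg_exist[of "{..<n}" f] False by (auto simp: dev_def f_def)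
      obtain Y where Y: "Y \<in> row_margin_sets m n s"
        "card {k. (k, j) \<in> X} = Suc (card {k. (k, j) \<in> Y})"
        "card {k. (k, j') \<in> Y} = Suc (card {k. (k, j') \<in> X})"
        "\<forall>l. l \<noteq> j \<and> l \<noteq> j' \<longrightarrow> card {k. (k, l) \<in> Y} = card {k. (k, l) \<in> X}"
        "card (sym_diff X Y) \<le> 4"
        using move_between_columns[OF X, of j t j' a a' b] j a b L less.prems(2)
        unfolding dev_real f_def by force
      have ne: "j \<noteq> j'"
        using j by auto
      have "dev Y = (\<Sum>l<n. \<bar>f l\<bar> - (if l = j then 1 else 0) - (if l = j' then 1 else 0))"
        unfolding dev_def
      proof (rule sum.cong[OF refl])
        fix l
        show "\<bar>int (card {i. (i, l) \<in> Y}) - int (t l)\<bar>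
            = \<bar>f l\<bar> - (if l = j then 1 else 0) - (if l = j' then 1 else 0)"
          using Y(2-4) j ne by (auto simp: f_def)
      qed
      also have "\<dots> = dev X - 2"
        using j by (simp add: sum_subtractf dev_def f_def)
      finally have devY: "dev Y = dev X - 2" .
      have "nat (dev Y) < nat (dev X)"
        using devY dev_nonneg[of Y] by simp
      moreover have "dev Y \<le> L"
        using devY less.prems(2) by simp
      ultimately obtain Z where Z: "Z \<in> margin_sets m n s t"
        "int (card (sym_diff Y Z)) \<le> 2 * dev Y"
        using less.hyps[OF _ Y(1)] by blast
      have "finite Z"
        using Z(1) row_margin_setsD(2) by (auto simp: margin_sets_def)
      hence "card (sym_diff X Z) \<le> card (sym_diff X Y) + card (sym_diff Y Z)"
        using row_margin_setsD(2)[OF X] row_margin_setsD(2)[OF Y(1)]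
        by (intro card_sym_diff_triangle)
      hence "int (card (sym_diff X Z)) \<le> 2 * dev X"
        using Y(5) Z(2) devY by simp
      thus ?thesis
        using Z(1) by blast
    qed
  qed
  from this[OF assms(1)] assms(7) obtain Y where
    "Y \<in> margin_sets m n s t" "int (card (sym_diff X Y)) \<le> 2 * dev X"
    unfolding dev_real by blast
  moreover from this(2) have "real (card (sym_diff X Y)) \<le> 2 * real_of_int (dev X)"
    by linarith
  ultimately show ?thesis
    using assms(7) unfolding dev_real by force
qed

section \<open>Comparing cardinalities through Hamming balls\<close>

lemma card_subsets_card_le:
  assumes "finite A"
  shows "card {D. D \<subseteq> A \<and> card D \<le> k} \<le> (card A + 1) ^ k"
proof (induction k)
  case 0
  have "{D. D \<subseteq> A \<and> card D \<le> 0} \<subseteq> {{}}"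
    using assms by (auto dest: finite_subset)
  from card_mono[OF _ this] show ?case by simp
next
  case (Suc k)
  let ?S = "\<lambda>k. {D. D \<subseteq> A \<and> card D \<le> k}"
  have fin: "finite (?S k)" for k
    using assms by simp
  have "?S (Suc k) \<subseteq> ?S k \<union> (\<lambda>(D, x). insert x D) ` (?S k \<times> A)"
  proof
    fix D assume D: "D \<in> ?S (Suc k)"
    have finD: "finite D"
      using D assms finite_subset by auto
    show "D \<in> ?S k \<union> (\<lambda>(D, x). insert x D) ` (?S k \<times> A)"
    proof (cases "D = {}")
      case False
      then obtain x where x: "x \<in> D" by auto
      have "D = insert x (D - {x})" "card (D - {x}) \<le> k"
        using x D finD by auto
      thus ?thesis
        using x D by (intro UnI2 image_eqI[of _ _ "(D - {x}, x)"]) auto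
    qed auto
  qed
  hence "card (?S (Suc k)) \<le> card (?S k \<union> (\<lambda>(D, x). insert x D) ` (?S k \<times> A))"
    using fin assms by (intro card_mono) auto
  also have "\<dots> \<le> card (?S k) + card ((\<lambda>(D, x). insert x D) ` (?S k \<times> A))"
    by (rule card_Un_le)
  also have "\<dots> \<le> card (?S k) + card (?S k \<times> A)"
    using fin assms by (intro add_left_mono card_image_le) auto
  also have "\<dots> = card (?S k) + card (?S k) * card A"
    by (simp add: card_cartesian_product)
  also have "\<dots> = card (?S k) * (card A + 1)"
    by simp
  also have "\<dots> \<le> (card A + 1) ^ k * (card A + 1)"
    using Suc.IH by (rule mult_right_mono) simp
  finally show ?case
    by (simp add: mult.commute)
qed

text \<open>Each \<open>X\<close> is recovered from a nearby \<open>Y\<close> and the set of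
  elements in which they differ, so counting such pairs suffices.\<close>

lemma card_le_card_ball:
  assumes "finite U" "\<A> \<subseteq> Pow U" "\<B> \<subseteq> Pow U"
    and "\<And>X. X \<in> \<B> \<Longrightarrow> \<exists>Y\<in>\<A>. card (sym_diff X Y) \<le> k"
  shows "card \<B> \<le> card \<A> * (card U + 1) ^ k"
proof -
  let ?S = "{D. D \<subseteq> U \<and> card D \<le> k}"
  have fin: "finite \<A>" "finite ?S"
    using assms finite_subset[of \<A> "Pow U"] by auto
  have "\<B> \<subseteq> (\<lambda>(Y, D). sym_diff Y D) ` (\<A> \<times> ?S)"
  proof
    fix X assume X: "X \<in> \<B>"
    then obtain Y where Y: "Y \<in> \<A>" "card (sym_diff X Y) \<le> k"
      using assms by blast
    have "X = sym_diff Y (sym_diff X Y)" "sym_diff X Y \<subseteq> U"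
      using X Y assms by auto
    thus "X \<in> (\<lambda>(Y, D). sym_diff Y D) ` (\<A> \<times> ?S)"
      using Y by (intro image_eqI[of _ _ "(Y, sym_diff X Y)"]) auto
  qed
  hence "card \<B> \<le> card ((\<lambda>(Y, D). sym_diff Y D) ` (\<A> \<times> ?S))"
    using fin by (intro card_mono) auto
  also have "\<dots> \<le> card \<A> * card ?S"
    unfolding card_cartesian_product[symmetric] using fin by (intro card_image_le) auto
  also have "\<dots> \<le> card \<A> * (card U + 1) ^ k"
    using card_subsets_card_le[OF assms(1)] by (rule mult_left_mono) simp
  finally show ?thesis .
qed

text \<open>The deviations from the mean \<open>\<tau>\<close> cancel, so an unbalanced set has a
  large excess of ones in some set \<open>J\<close> of columns. The Chernoff bound for
  \<open>J\<close> is strong enough for a union bound over all \<open>2 ^ n\<close> choices.\<close>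

lemma card_column_unbalanced_le:
  fixes m n :: nat and s :: "nat \<Rightarrow> nat" and \<tau> :: real
  defines "\<tau> \<equiv> (\<Sum>i<m. real (s i)) / real n"
  assumes "0 < m" "0 < n" and s: "\<And>i. i < m \<Longrightarrow> s i \<le> n"
  shows "real (card {X \<in> row_margin_sets m n s.
      6 * real n * sqrt m < (\<Sum>l<n. \<bar>real (card {i. (i, l) \<in> X}) - \<tau>\<bar>)})
    \<le> real (card (row_margin_sets m n s)) / 2"
proof -
  let ?R = "row_margin_sets m n s"
  let ?F = "\<lambda>J. {..<m} \<times> J"
  let ?B = "\<lambda>J. {X \<in> ?R. \<tau> * real (card J) + 3 * real n * sqrt m \<le> real (card (X \<inter> ?F J))}"
  let ?U = "{X \<in> ?R. 6 * real n * sqrt m < (\<Sum>l<n. \<bar>real (card {i. (i, l) \<in> X}) - \<tau>\<bar>)}"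
  have "(\<Sum>i<m. real (s i)) \<le> (\<Sum>i<m. real n)"
    using s by (intro sum_mono) auto
  hence \<tau>: "0 \<le> \<tau>" "\<tau> \<le> real m"
    using assms(2,3) by (auto simp: \<tau>_def field_simps sum_nonneg)
  have "?U \<subseteq> (\<Union>J\<in>Pow {..<n}. ?B J)"
  proof
    fix X assume X: "X \<in> ?U"
    hence XR: "X \<in> ?R" by simp
    define c where "c l = real (card {i. (i, l) \<in> X}) - \<tau>" for l
    \<comment> \<open>The columns at or above the mean carry exactly half of the total absolute
      deviation, which turns the constant 6 into 3.\<close>
    define J where "J = {l \<in> {..<n}. 0 \<le> c l}"
    have "(\<Sum>l<n. real (card {i. (i, l) \<in> X})) = (\<Sum>i<m. real (s i))"
      using card_eq_sum_card_cols[OF row_margin_setsD(1)[OF XR]]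
        card_eq_sum_card_rows[OF row_margin_setsD(1)[OF XR]] row_margin_setsD(5)[OF XR]
      by (simp flip: of_nat_sum)
    hence "(\<Sum>l<n. c l) = 0"
      using assms(3) by (simp add: c_def sum_subtractf \<tau>_def)
    hence "(\<Sum>l<n. \<bar>c l\<bar>) = (\<Sum>l<n. \<bar>c l\<bar> + c l)"
      by (simp add: sum.distrib)
    also have "\<dots> = (\<Sum>l<n. if 0 \<le> c l then 2 * c l else 0)"
      by (intro sum.cong) auto
    also have "\<dots> = 2 * (\<Sum>l\<in>J. c l)"
      by (simp add: J_def sum.inter_filter[symmetric] sum_distrib_left)
    finally have "3 * real n * sqrt m < (\<Sum>l\<in>J. c l)"
      using X by (simp add: c_def)
    also have "\<dots> = real (\<Sum>l\<in>J. card {i. (i, l) \<in> X}) - \<tau> * real (card J)"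
      by (simp add: c_def sum_subtractf)
    also have "(\<Sum>l\<in>J. card {i. (i, l) \<in> X}) = card (X \<inter> ?F J)"
    proof -
      have "X \<inter> ?F J \<subseteq> {..<m} \<times> {..<n}"
        using row_margin_setsD(1)[OF XR] by auto
      from card_eq_sum_card_cols[OF this]
      have "card (X \<inter> ?F J) = (\<Sum>l<n. card {i. (i, l) \<in> X \<inter> ?F J})" .
      also have "\<dots> = (\<Sum>l<n. if 0 \<le> c l then card {i. (i, l) \<in> X} else 0)"
        using row_margin_setsD(1)[OF XR]
        by (intro sum.cong refl) (auto simp: J_def intro!: arg_cong[of _ _ card])
      also have "\<dots> = (\<Sum>l\<in>J. card {i. (i, l) \<in> X})"
        by (simp add: J_def sum.inter_filter[symmetric])
      finally show ?thesis ..
    qed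
    finally show "X \<in> (\<Union>J\<in>Pow {..<n}. ?B J)"
      using XR by (intro UN_I[of J]) (auto simp: J_def)
  qed
  hence "card ?U \<le> card (\<Union>J\<in>Pow {..<n}. ?B J)"
    by (intro card_mono) auto
  also have "\<dots> \<le> (\<Sum>J\<in>Pow {..<n}. card (?B J))"
    by (intro card_UN_le) auto
  finally have "real (card ?U) \<le> (\<Sum>J\<in>Pow {..<n}. real (card (?B J)))"
    by (simp flip: of_nat_sum)
  also have "\<dots> \<le> (\<Sum>J\<in>Pow {..<n}. real (card ?R) * exp (- 2 * real n))"
  proof (rule sum_mono)
    fix J assume J: "J \<in> Pow {..<n}"
    \<comment> \<open>With this tilt the quadratic term costs at most \<open>n\<close> while the
      excess gains \<open>3 * n\<close>; the remaining \<open>exp (- 2 * n)\<close> beats the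
      \<open>2 ^ n\<close> column sets.\<close>
    define \<theta> where "\<theta> = 1 / sqrt m"
    have \<theta>: "0 \<le> \<theta>" "\<theta> \<le> 1" "\<theta>\<^sup>2 = 1 / real m" "\<theta> * sqrt m = 1"
      using assms(2) by (auto simp: \<theta>_def power_divide)
    have cardJ: "real (card J) \<le> real n"
      using J card_mono[of "{..<n}" J] by simp
    have p: "(\<Sum>(i, j)\<in>?F J. real (s i) / real n) = \<tau> * real (card J)"
      by (simp add: sum.cartesian_product[symmetric] \<tau>_def sum_divide_distrib sum_distrib_left
        mult.commute)
    have "real (card J) * \<tau> \<le> real n * real m"
      using cardJ \<tau> by (intro mult_mono) auto
    hence "\<theta>\<^sup>2 * (\<tau> * real (card J)) \<le> real n"
      using assms(2) unfolding \<theta>(3) by (simp add: field_simps)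
    moreover have "(\<theta> + \<theta>\<^sup>2) * (\<tau> * real (card J)) - \<theta> * (\<tau> * real (card J) + 3 * real n * sqrt m)
        = \<theta>\<^sup>2 * (\<tau> * real (card J)) - 3 * real n * (\<theta> * sqrt m)"
      by (simp add: algebra_simps)
    ultimately have "exp ((\<theta> + \<theta>\<^sup>2) * (\<tau> * real (card J))
        - \<theta> * (\<tau> * real (card J) + 3 * real n * sqrt m)) \<le> exp (- 2 * real n)"
      using \<theta>(4) by simp
    thus "real (card (?B J)) \<le> real (card ?R) * exp (- 2 * real n)"
      using card_row_margin_sets_tail[of "?F J" m n s \<theta> "\<tau> * real (card J) + 3 * real n * sqrt m"]
        J s \<theta> unfolding p
      by (meson Pow_iff Sigma_mono mult_left_mono of_nat_0_le_iff order_refl order_trans)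
  qed
  also have "\<dots> = real (card ?R) * (2 * exp (- 2)) ^ n"
    by (simp add: card_Pow power_mult_distrib exp_of_nat_mult[symmetric] mult_ac)
  also have "\<dots> \<le> real (card ?R) * (1 / 2)"
  proof (rule mult_left_mono)
    have "2 * 2 \<le> exp 1 * exp (1 :: real)"
      using exp_ge_add_one_self[of 1] by (intro mult_mono) auto
    hence "2 * exp (- 2 :: real) \<le> 1 / 2"
      by (simp add: exp_minus field_simps flip: exp_add)
    hence "(2 * exp (- 2 :: real)) ^ n \<le> (1 / 2) ^ n"
      by (intro power_mono) auto
    also have "\<dots> \<le> (1 / 2) ^ 1"
      using assms(3) by (intro power_decreasing) auto
    finally show "(2 * exp (- 2 :: real)) ^ n \<le> 1 / 2"
      by simp
  qed simp
  finally show ?thesis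
    by simp
qed

text \<open>At least half of the sets with the right row sums have nearly equal column sums. Each of
  these lies within \<open>2 * L\<close> cells of a set with both margins right, and the ball
  estimate converts this into a lower bound for the number of the latter.\<close>

lemma card_margin_sets_ge:
  fixes m n :: nat and s t :: "nat \<Rightarrow> nat" and a a' b L \<tau> :: real
  defines "\<tau> \<equiv> (\<Sum>i<m. real (s i)) / real n"
  assumes "0 < m" "0 < n" and s: "\<And>i. i < m \<Longrightarrow> s i \<le> n"
    and st: "(\<Sum>i<m. s i) = (\<Sum>j<n. t j)"
    and a: "\<And>l. l < n \<Longrightarrow> a \<le> real (t l)" "\<And>l. l < n \<Longrightarrow> real (t l) \<le> a'"
    and b: "\<And>i. i < m \<Longrightarrow> real (s i) \<le> b" "0 \<le> b"
    and L: "6 * real n * sqrt m + (\<Sum>l<n. \<bar>\<tau> - real (t l)\<bar>) \<le> L"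
    and abL: "a' * b + L < real n * a"
  shows "real (card (row_margin_sets m n s)) / 2
    \<le> real (card (margin_sets m n s t)) * exp (2 * L * ln (real (m * n + 1)))"
proof -
  let ?R = "row_margin_sets m n s"
  let ?dev = "\<lambda>X. \<Sum>l<n. \<bar>real (card {i. (i, l) \<in> X}) - \<tau>\<bar>"
  let ?B = "{X \<in> ?R. ?dev X \<le> 6 * real n * sqrt m}"
  \<comment> \<open>A number of cells is an integer, so rounding the radius \<open>2 * L\<close>
    down loses nothing.\<close>
  define k where "k = nat \<lfloor>2 * L\<rfloor>"
  have "0 \<le> 6 * real n * sqrt m + (\<Sum>l<n. \<bar>\<tau> - real (t l)\<bar>)"
    by (intro add_nonneg_nonneg sum_nonneg) auto
  hence L0: "0 \<le> L"
    using L by linarith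
  have "?R = ?B \<union> {X \<in> ?R. 6 * real n * sqrt m < ?dev X}"
    by auto
  hence "card ?R \<le> card ?B + card {X \<in> ?R. 6 * real n * sqrt m < ?dev X}"
    by (metis (no_types, lifting) card_Un_le)
  moreover have "real (card {X \<in> ?R. 6 * real n * sqrt m < ?dev X}) \<le> real (card ?R) / 2"
    unfolding \<tau>_def by (rule card_column_unbalanced_le) fact+
  ultimately have "real (card ?R) / 2 \<le> real (card ?B)"
    by linarith
  also have "card ?B \<le> card (margin_sets m n s t) * (card ({..<m} \<times> {..<n}) + 1) ^ k"
  proof (rule card_le_card_ball)
    show "margin_sets m n s t \<subseteq> Pow ({..<m} \<times> {..<n})" "?B \<subseteq> Pow ({..<m} \<times> {..<n})"
      by (auto simp: margin_sets_def row_margin_sets_def)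
    fix X assume X: "X \<in> ?B"
    have "(\<Sum>l<n. \<bar>real (card {i. (i, l) \<in> X}) - real (t l)\<bar>)
        \<le> (\<Sum>l<n. \<bar>real (card {i. (i, l) \<in> X}) - \<tau>\<bar> + \<bar>\<tau> - real (t l)\<bar>)"
      by (intro sum_mono) linarith
    also have "\<dots> \<le> L"
      using X L by (simp add: sum.distrib)
    finally obtain Y where "Y \<in> margin_sets m n s t" "real (card (sym_diff X Y)) \<le> 2 * L"
      using repair_columns[of X m n s t a a' b L] X st a b abL by blast
    thus "\<exists>Y\<in>margin_sets m n s t. card (sym_diff X Y) \<le> k"
      unfolding k_def by (intro bexI[of _ Y]) (auto simp: le_nat_iff le_floor_iff)
  qed auto
  also have "real (card (margin_sets m n s t) * (card ({..<m} \<times> {..<n}) + 1) ^ k)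
      = real (card (margin_sets m n s t)) * real (m * n + 1) ^ k"
    unfolding card_cartesian_product of_nat_mult of_nat_power by simp
  also have "real (m * n + 1) ^ k = exp (real k * ln (real (m * n + 1)))"
  proof -
    have "0 < real (m * n + 1)"
      by (subst of_nat_0_less_iff) simp
    thus ?thesis
      by (simp only: exp_of_nat_mult exp_ln)
  qed
  also have "\<dots> \<le> exp (2 * L * ln (real (m * n + 1)))"
    using L0 unfolding k_def by (intro iffD2[OF exp_le_cancel_iff] mult_right_mono) auto
  finally show ?thesis
    by (simp add: mult_left_mono)
qed

section \<open>Acyclic orientations of the free cells\<close>

text \<open>A permutation along edges stands in for an explicit directed cycle. After choosing one
  successor for each vertex, a smallest nonempty set closed under the choice must be mapped onto
  itself.\<close>

lemma bij_on_subset_of_successors: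
  assumes "finite W" "W \<noteq> {}" "\<And>v. v \<in> W \<Longrightarrow> \<exists>u\<in>W. (v, u) \<in> r"
  shows "\<exists>C f. C \<noteq> {} \<and> bij_betw f C C \<and> (\<forall>v\<in>C. (v, f v) \<in> r)"
proof -
  obtain f where f: "\<And>v. v \<in> W \<Longrightarrow> f v \<in> W \<and> (v, f v) \<in> r"
    using assms(3) by metis
  let ?P = "\<lambda>C. C \<subseteq> W \<and> C \<noteq> {} \<and> f ` C \<subseteq> C"
  have "?P W"
    using f assms(2) by auto
  then obtain C where C: "?P C" and least: "\<And>D. ?P D \<Longrightarrow> card C \<le> card D"
    using ex_has_least_nat[of ?P W card] by blast
  have finC: "finite C"
    using C assms(1) finite_subset by auto
  have "?P (f ` C)"
    using C by auto
  hence "card (f ` C) = card C"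
    using least[of "f ` C"] card_image_le[OF finC, of f] by simp
  hence "bij_betw f C C"
    using C finC by (auto simp: bij_betw_def card_subset_eq intro: eq_card_imp_inj_on)
  thus ?thesis
    using C f by blast
qed

text \<open>The rank of a vertex is the number of vertices from which it can be reached. Extensional
  functions with bounded values form a finite set, over which a union bound can be taken.\<close>

lemma rank_of_acyclic:
  assumes "acyclic r" "r \<subseteq> V \<times> V" "finite V"
  shows "\<exists>\<rho>. \<rho> \<in> V \<rightarrow>\<^sub>E {..card V} \<and> (\<forall>(u, v)\<in>r. \<rho> u < (\<rho> v :: nat))"
proof -
  define \<rho> where "\<rho> = (\<lambda>v\<in>V. card {u. (u, v) \<in> r\<^sup>+})"
  have sub: "{u. (u, v) \<in> r\<^sup>+} \<subseteq> V" for v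
    using trancl_subset_Sigma[OF assms(2)] by auto
  have "\<rho> \<in> V \<rightarrow>\<^sub>E {..card V}"
    using card_mono[OF assms(3) sub] by (auto simp: \<rho>_def)
  moreover have "\<rho> u < \<rho> v" if "(u, v) \<in> r" for u v
  proof -
    \<comment> \<open>The inclusion is strict because \<open>u\<close> precedes \<open>v\<close>
      but, by acyclicity, not itself.\<close>
    have "{w. (w, u) \<in> r\<^sup>+} \<subset> {w. (w, v) \<in> r\<^sup>+}"
      using that assms(1) by (auto simp: acyclic_def intro: trancl_into_trancl)
    thus ?thesis
      using that assms(2,3) sub by (auto simp: \<rho>_def intro!: psubset_card_mono intro: finite_subset)
  qed
  ultimately show ?thesis
    by blast
qed

lemma card_exchange:
  assumes "finite A" "P \<subseteq> A" "finite Q" "Q \<inter> A = {}" "card P = card Q"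
  shows "card (A - P \<union> Q) = card A"
proof -
  have "card (A - P \<union> Q) = card (A - P) + card Q"
    using assms by (intro card_Un_disjoint) auto
  also have "\<dots> = card A"
    using assms card_mono[of A P] by (simp add: card_Diff_subset finite_subset)
  finally show ?thesis .
qed

text \<open>Orient the free cells from rows to columns where the matrix is 1 and from columns to rows
  where it is 0. Flipping the cells along a directed cycle preserves the margins.\<close>

definition cell_orientation :: "(nat \<times> nat) set \<Rightarrow> (nat \<times> nat) set \<Rightarrow> ((nat + nat) \<times> (nat + nat)) set" where
  "cell_orientation X E = {(Inl i, Inr j) |i j. (i, j) \<in> X \<inter> E} \<union> {(Inr j, Inl i) |i j. (i, j) \<in> E - X}"

lemma cell_orientation_iff [simp]:
  "(Inl i, v) \<in> cell_orientation X E \<longleftrightarrow> (\<exists>j. v = Inr j \<and> (i, j) \<in> X \<inter> E)"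
  "(Inr j, v) \<in> cell_orientation X E \<longleftrightarrow> (\<exists>i. v = Inl i \<and> (i, j) \<in> E - X)"
  by (auto simp: cell_orientation_def)

text \<open>Each vertex of \<open>C\<close> is left by one chosen edge and entered by one. For a row
  these are a 1 in \<open>P\<close> and a 0 in \<open>Q\<close>, for a column a 0 in
  \<open>Q\<close> and a 1 in \<open>P\<close>. Exchanging \<open>P\<close> for \<open>Q\<close>
  therefore keeps every margin.\<close>

lemma flip_along_bij:
  assumes X: "X \<in> margin_sets m n s t" and E: "E \<subseteq> {..<m} \<times> {..<n}"
    and f: "bij_betw f C C" and ne: "C \<noteq> {}" and fE: "\<And>v. v \<in> C \<Longrightarrow> (v, f v) \<in> cell_orientation X E"
  shows "\<exists>Y \<in> margin_sets m n s t. Y \<noteq> X \<and> sym_diff X Y \<subseteq> E"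
proof -
  define P where "P = {(i, j). Inl i \<in> C \<and> f (Inl i) = Inr j}"
  define Q where "Q = {(i, j). Inr j \<in> C \<and> f (Inr j) = Inl i}"
  define Y where "Y = X - P \<union> Q"
  have XR: "X \<in> row_margin_sets m n s"
    using X by (simp add: margin_sets_def)
  have P: "P \<subseteq> X \<inter> E" and Q: "Q \<subseteq> E - X"
    using fE by (force simp: P_def Q_def)+
  have finE: "finite E"
    using E by (rule finite_subset) auto
  have L: "\<exists>j. f (Inl i) = Inr j" if "Inl i \<in> C" for i
    using fE[OF that] by auto
  have R: "\<exists>i. f (Inr j) = Inl i" if "Inr j \<in> C" for j
    using fE[OF that] by auto
  have pre: "\<exists>u\<in>C. f u = v" if "v \<in> C" for v
  proof -
    have "v \<in> f ` C"
      using f that by (simp add: bij_betw_def)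
    thus ?thesis by auto
  qed
  have L': "\<exists>j. Inr j \<in> C \<and> f (Inr j) = Inl i" if C: "Inl i \<in> C" for i
  proof -
    obtain u where u: "u \<in> C" "f u = Inl i"
      using pre[OF C] by blast
    thus ?thesis
      using L by (cases u) fastforce+
  qed
  have R': "\<exists>i. Inl i \<in> C \<and> f (Inl i) = Inr j" if C: "Inr j \<in> C" for j
  proof -
    obtain u where u: "u \<in> C" "f u = Inr j"
      using pre[OF C] by blast
    thus ?thesis
      using R by (cases u) fastforce+
  qed
  have fC: "f v \<in> C" if "v \<in> C" for v
    using f that by (auto simp: bij_betw_def)
  have inj: "u = v" if "f u = f v" "u \<in> C" "v \<in> C" for u v
    using f that by (auto simp: bij_betw_def inj_on_def)
  have finP: "finite P" and finQ: "finite Q"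
    using P Q finE by (auto intro: finite_subset)
  have card_row: "card {j. (i, j) \<in> P} = card {j. (i, j) \<in> Q}" for i
  proof (cases "Inl i \<in> C")
    case True
    then obtain j j' where j: "f (Inl i) = Inr j" "Inr j' \<in> C" "f (Inr j') = Inl i"
      using L[OF True] L'[OF True] by blast
    have "l = j'" if "(i, l) \<in> Q" for l
      using inj[of "Inr l" "Inr j'"] that j by (simp add: Q_def)
    moreover have "(i, j') \<in> Q"
      using j by (simp add: Q_def)
    ultimately have "{j. (i, j) \<in> Q} = {j'}"
      by blast
    moreover have "{j. (i, j) \<in> P} = {j}"
      using True j by (auto simp: P_def)
    ultimately show ?thesis by simp
  next
    case False
    have "(i, l) \<notin> Q" for l
      using fC[of "Inr l"] False by (auto simp: Q_def)
    moreover have "(i, l) \<notin> P" for l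
      using False by (simp add: P_def)
    ultimately have "{j. (i, j) \<in> P} = {}" "{j. (i, j) \<in> Q} = {}"
      by simp_all
    thus ?thesis by simp
  qed
  have card_col: "card {i. (i, j) \<in> P} = card {i. (i, j) \<in> Q}" for j
  proof (cases "Inr j \<in> C")
    case True
    then obtain i i' where i: "f (Inr j) = Inl i" "Inl i' \<in> C" "f (Inl i') = Inr j"
      using R[OF True] R'[OF True] by blast
    have "l = i'" if "(l, j) \<in> P" for l
      using inj[of "Inl l" "Inl i'"] that i by (simp add: P_def)
    moreover have "(i', j) \<in> P"
      using i by (simp add: P_def)
    ultimately have "{i. (i, j) \<in> P} = {i'}"
      by blast
    moreover have "{i. (i, j) \<in> Q} = {i}"
      using True i by (auto simp: Q_def)
    ultimately show ?thesis by simp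
  next
    case False
    have "(l, j) \<notin> P" for l
      using fC[of "Inl l"] False by (auto simp: P_def)
    moreover have "(l, j) \<notin> Q" for l
      using False by (simp add: Q_def)
    ultimately have "{i. (i, j) \<in> P} = {}" "{i. (i, j) \<in> Q} = {}"
      by simp_all
    thus ?thesis by simp
  qed
  have fin: "finite {j. (i, j) \<in> Q}" "finite {i'. (i', i) \<in> Q}" for i
    by (rule finite_subset[of _ "snd ` Q"], force, use finQ in simp,
        rule finite_subset[of _ "fst ` Q"], force, use finQ in simp)
  have "card {j. (i, j) \<in> Y} = card {j. (i, j) \<in> X}" for i
  proof -
    have "{j. (i, j) \<in> Y} = {j. (i, j) \<in> X} - {j. (i, j) \<in> P} \<union> {j. (i, j) \<in> Q}"
      by (auto simp: Y_def)
    also have "card \<dots> = card {j. (i, j) \<in> X}"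
      using P Q row_margin_setsD(3)[OF XR] card_row fin by (intro card_exchange) auto
    finally show ?thesis .
  qed
  moreover have "card {i. (i, j) \<in> Y} = card {i. (i, j) \<in> X}" for j
  proof -
    have "{i. (i, j) \<in> Y} = {i. (i, j) \<in> X} - {i. (i, j) \<in> P} \<union> {i. (i, j) \<in> Q}"
      by (auto simp: Y_def)
    also have "card \<dots> = card {i. (i, j) \<in> X}"
      using P Q row_margin_setsD(4)[OF XR] card_col fin by (intro card_exchange) auto
    finally show ?thesis .
  qed
  moreover have "Y \<subseteq> {..<m} \<times> {..<n}"
    using row_margin_setsD(1)[OF XR] Q E by (auto simp: Y_def)
  ultimately have "Y \<in> margin_sets m n s t"
    using X by (auto simp: margin_sets_def row_margin_sets_def)
  moreover have "sym_diff X Y \<subseteq> E"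
    using P Q by (auto simp: Y_def)
  moreover have "Y \<noteq> X"
  proof -
    obtain v where v: "v \<in> C" using ne by auto
    have "P \<union> Q \<noteq> {}"
    proof (cases v)
      case (Inl i)
      then obtain j where "f (Inl i) = Inr j"
        using L v by blast
      hence "(i, j) \<in> P"
        using v Inl by (simp add: P_def)
      thus ?thesis by blast
    next
      case (Inr j)
      then obtain i where "f (Inr j) = Inl i"
        using R v by blast
      hence "(i, j) \<in> Q"
        using v Inr by (simp add: Q_def)
      thus ?thesis by blast
    qed
    moreover have "P \<union> Q \<subseteq> sym_diff X Y"
      using P Q by (auto simp: Y_def)
    ultimately show ?thesis by auto
  qed
  ultimately show ?thesis by blast
qed

text \<open>Up to permutations of rows and columns these are the staircase (Ferrers) shapes.\<close>

definition rank_region :: "nat \<Rightarrow> nat \<Rightarrow> (nat + nat \<Rightarrow> nat) \<Rightarrow> (nat \<times> nat) set" where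
  "rank_region m n \<rho> = {(i, j). i < m \<and> j < n \<and> \<rho> (Inl i) < \<rho> (Inr j)}"

text \<open>If the orientation were not acyclic, a finite set of vertices with successors inside the
  set would yield a permutation along edges, and flipping would give a second completion. A rank
  increasing along edges places the free ones, whose edges leave rows, inside the region and the
  free zeros outside.\<close>

lemma rank_region_of_unique:
  assumes X: "X \<in> margin_sets m n s t" and E: "E \<subseteq> {..<m} \<times> {..<n}"
    and unique: "\<And>Y. Y \<in> margin_sets m n s t \<Longrightarrow> sym_diff X Y \<subseteq> E \<Longrightarrow> Y = X"
  shows "\<exists>\<rho> \<in> ({..<m} <+> {..<n}) \<rightarrow>\<^sub>E {..m + n}.
    X \<inter> E \<subseteq> rank_region m n \<rho> \<and> (E - X) \<inter> rank_region m n \<rho> = {}"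
proof -
  let ?V = "{..<m} <+> {..<n}" and ?r = "cell_orientation X E"
  have sub: "?r \<subseteq> ?V \<times> ?V"
    using E by (auto simp: cell_orientation_def)
  have "wf (?r\<inverse>)"
  proof (subst wf_eq_minimal, intro allI impI)
    fix W and x :: "nat + nat" assume x: "x \<in> W"
    show "\<exists>z\<in>W. \<forall>y. (y, z) \<in> ?r\<inverse> \<longrightarrow> y \<notin> W"
    proof (rule ccontr)
      assume "\<not> ?thesis"
      hence *: "\<And>v. v \<in> W \<Longrightarrow> \<exists>u\<in>W. (v, u) \<in> ?r"
        by auto
      have "W \<subseteq> ?V"
        using * sub by blast
      hence "finite W"
        by (rule finite_subset) auto
      then obtain C f where "C \<noteq> {}" "bij_betw f C C" "\<forall>v\<in>C. (v, f v) \<in> ?r"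
        using bij_on_subset_of_successors[of W ?r] x * by blast
      thus False
        using flip_along_bij[OF X E] unique by blast
    qed
  qed
  hence "acyclic ?r"
    using wf_acyclic by (auto simp: acyclic_converse)
  moreover have "card ?V = m + n"
    by (simp add: card_Plus)
  ultimately obtain \<rho> where \<rho>: "\<rho> \<in> ?V \<rightarrow>\<^sub>E {..m + n}" "\<forall>(u, v)\<in>?r. \<rho> u < \<rho> v"
    using rank_of_acyclic[OF _ sub] by auto
  have "X \<inter> E \<subseteq> rank_region m n \<rho>"
  proof clarify
    fix i j assume "(i, j) \<in> X" "(i, j) \<in> E"
    moreover from this have "(Inl i, Inr j) \<in> ?r" by simp
    ultimately show "(i, j) \<in> rank_region m n \<rho>"
      using \<rho>(2) E by (auto simp: rank_region_def)
  qed
  moreover have "(i, j) \<notin> rank_region m n \<rho>" if "(i, j) \<in> E - X" for i j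
  proof -
    from that have "(Inr j, Inl i) \<in> ?r" by simp
    from bspec[OF \<rho>(2) this] show ?thesis
      by (auto simp: rank_region_def)
  qed
  ultimately show ?thesis
    using \<rho>(1) by (intro bexI[of _ \<rho>]) auto
qed

section \<open>Small defining sets force an excess of ones in a region\<close>

text \<open>A free cell is either a one inside \<open>F\<close> or a zero outside \<open>F\<close>,
  so \<open>E\<close> is covered by \<open>X \<inter> F\<close> and the complement of
  \<open>F \<union> X\<close>; the rest is inclusion-exclusion.\<close>

lemma card_le_of_rank_region:
  assumes "X \<subseteq> {..<m} \<times> {..<n}" "E \<subseteq> {..<m} \<times> {..<n}" "F \<subseteq> {..<m} \<times> {..<n}"
    and "X \<inter> E \<subseteq> F" "(E - X) \<inter> F = {}"
  shows "real (card E) \<le> real m * real n - real (card X) + 2 * real (card (X \<inter> F)) - real (card F)"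
proof -
  let ?U = "{..<m} \<times> {..<n}"
  have fin: "finite X" "finite E" "finite F"
    using assms finite_subset[of _ ?U] by auto
  have "card E \<le> card (X \<inter> F \<union> (?U - (F \<union> X)))"
    using assms fin by (intro card_mono) auto
  also have "\<dots> \<le> card (X \<inter> F) + card (?U - (F \<union> X))"
    by (rule card_Un_le)
  also have "card (?U - (F \<union> X)) = card ?U - card (F \<union> X)"
    using assms fin by (intro card_Diff_subset) auto
  finally have "card E \<le> card (X \<inter> F) + (card ?U - card (F \<union> X))" .
  moreover have "card (F \<union> X) \<le> card ?U"
    using assms by (intro card_mono) auto
  moreover have "card F + card X = card (F \<union> X) + card (X \<inter> F)"
    using card_Un_Int[OF fin(3,1)] by (simp add: Int_commute)
  moreover have "card ?U = m * n"
    by (simp add: card_cartesian_product)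
  ultimately have "card E + card F + card X \<le> m * n + 2 * card (X \<inter> F)"
    by linarith
  hence "real (card E + card F + card X) \<le> real (m * n + 2 * card (X \<inter> F))"
    by (rule of_nat_mono)
  thus ?thesis
    by simp
qed

text \<open>\<open>E\<close> plays the role of the set of empty cells of a partial matrix.\<close>

definition small_determining :: "nat \<Rightarrow> nat \<Rightarrow> (nat \<Rightarrow> nat) \<Rightarrow> (nat \<Rightarrow> nat) \<Rightarrow> real \<Rightarrow> (nat \<times> nat) set set" where
  "small_determining m n s t \<Delta> = {X \<in> margin_sets m n s t. \<exists>E \<subseteq> {..<m} \<times> {..<n}.
     (\<forall>Y \<in> margin_sets m n s t. sym_diff X Y \<subseteq> E \<longrightarrow> Y = X) \<and>
     real m * real n - real (card E) < real (card X) - \<Delta>}"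

text \<open>Determination by few cells forces \<open>X\<close> to fill at least
  \<open>\<Delta> / 2\<close> more than half of the cells of some region. Every row has density at
  most \<open>1 / 2 + \<eta>\<close>, so this is an upper tail event, and the first factor is the
  number of rank functions.\<close>

lemma card_small_determining_le:
  fixes \<theta> \<Delta> \<eta> :: real
  assumes s: "\<And>i. i < m \<Longrightarrow> s i \<le> n" and \<eta>: "\<And>i. i < m \<Longrightarrow> real (s i) / real n \<le> 1 / 2 + \<eta>" "0 \<le> \<eta>"
    and \<theta>: "0 \<le> \<theta>" "\<theta> \<le> 1"
  shows "real (card (small_determining m n s t \<Delta>))
    \<le> real (m + n + 1) ^ (m + n) * (real (card (row_margin_sets m n s)) *
        exp ((\<theta> * \<eta> + \<theta>\<^sup>2) * (real m * real n) - \<theta> * \<Delta> / 2))"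
proof -
  let ?R = "row_margin_sets m n s" and ?\<rho>s = "({..<m} <+> {..<n}) \<rightarrow>\<^sub>E {..m + n}"
  let ?F = "rank_region m n"
  let ?B = "\<lambda>\<rho>. {X \<in> ?R. real (card (?F \<rho>)) / 2 + \<Delta> / 2 \<le> real (card (X \<inter> ?F \<rho>))}"
  let ?e = "exp ((\<theta> * \<eta> + \<theta>\<^sup>2) * (real m * real n) - \<theta> * \<Delta> / 2)"
  have F: "?F \<rho> \<subseteq> {..<m} \<times> {..<n}" for \<rho>
    by (auto simp: rank_region_def)
  have fin\<rho>: "finite ?\<rho>s"
    by (intro finite_PiE) auto
  have "small_determining m n s t \<Delta> \<subseteq> (\<Union>\<rho>\<in>?\<rho>s. ?B \<rho>)"
  proof
    fix X assume "X \<in> small_determining m n s t \<Delta>"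
    then obtain E where X: "X \<in> margin_sets m n s t" and E: "E \<subseteq> {..<m} \<times> {..<n}"
      "\<And>Y. Y \<in> margin_sets m n s t \<Longrightarrow> sym_diff X Y \<subseteq> E \<Longrightarrow> Y = X"
      "real m * real n - real (card E) < real (card X) - \<Delta>"
      unfolding small_determining_def by blast
    obtain \<rho> where \<rho>: "\<rho> \<in> ?\<rho>s" "X \<inter> E \<subseteq> ?F \<rho>" "(E - X) \<inter> ?F \<rho> = {}"
      using rank_region_of_unique[OF X E(1,2)] by blast
    have XR: "X \<in> ?R"
      using X by (simp add: margin_sets_def)
    have "real (card (?F \<rho>)) / 2 + \<Delta> / 2 \<le> real (card (X \<inter> ?F \<rho>))"
      using card_le_of_rank_region[OF row_margin_setsD(1)[OF XR] E(1) F \<rho>(2,3)] E(3) by linarith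
    thus "X \<in> (\<Union>\<rho>\<in>?\<rho>s. ?B \<rho>)"
      using XR \<rho>(1) by blast
  qed
  hence "card (small_determining m n s t \<Delta>) \<le> card (\<Union>\<rho>\<in>?\<rho>s. ?B \<rho>)"
    using fin\<rho> by (intro card_mono) auto
  also have "\<dots> \<le> (\<Sum>\<rho>\<in>?\<rho>s. card (?B \<rho>))"
    using fin\<rho> by (rule card_UN_le)
  finally have "real (card (small_determining m n s t \<Delta>)) \<le> (\<Sum>\<rho>\<in>?\<rho>s. real (card (?B \<rho>)))"
    by (simp flip: of_nat_sum)
  also have "\<dots> \<le> (\<Sum>\<rho>\<in>?\<rho>s. real (card ?R) * ?e)"
  proof (rule sum_mono)
    fix \<rho>
    define p where "p = (\<Sum>(i, j)\<in>?F \<rho>. real (s i) / real n)"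
    define k where "k = real (card (?F \<rho>))"
    have "p \<le> (\<Sum>(i, j)\<in>?F \<rho>. 1 / 2 + \<eta>)"
      unfolding p_def using \<eta>(1) by (intro sum_mono) (auto simp: rank_region_def)
    hence p1: "p \<le> k / 2 + k * \<eta>"
      by (simp add: k_def algebra_simps)
    \<comment> \<open>This crude bound suffices in the term with \<open>\<theta>\<^sup>2\<close>;
      the sharper one is needed where \<open>\<theta> * k / 2\<close> has to cancel.\<close>
    have "p \<le> (\<Sum>(i, j)\<in>?F \<rho>. 1)"
      unfolding p_def using s by (intro sum_mono) (auto simp: rank_region_def divide_le_eq)
    hence p2: "p \<le> k"
      by (simp add: k_def)
    have "card (?F \<rho>) \<le> card ({..<m} \<times> {..<n})"
      using F by (intro card_mono) auto
    hence k: "k \<le> real m * real n"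
      by (simp add: k_def card_cartesian_product flip: of_nat_mult)
    have "(\<theta> + \<theta>\<^sup>2) * p - \<theta> * (k / 2 + \<Delta> / 2) = \<theta> * p + \<theta>\<^sup>2 * p - \<theta> * (k / 2 + \<Delta> / 2)"
      by (simp add: algebra_simps)
    also have "\<dots> \<le> \<theta> * (k / 2 + k * \<eta>) + \<theta>\<^sup>2 * k - \<theta> * (k / 2 + \<Delta> / 2)"
      using p1 p2 \<theta> by (intro diff_mono add_mono mult_left_mono) auto
    also have "\<dots> = (\<theta> * \<eta> + \<theta>\<^sup>2) * k - \<theta> * \<Delta> / 2"
      by (simp add: algebra_simps)
    also have "\<dots> \<le> (\<theta> * \<eta> + \<theta>\<^sup>2) * (real m * real n) - \<theta> * \<Delta> / 2"
      using k \<theta> \<eta>(2) by (intro diff_mono mult_left_mono) auto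
    finally have "real (card ?R) * exp ((\<theta> + \<theta>\<^sup>2) * p - \<theta> * (k / 2 + \<Delta> / 2)) \<le> real (card ?R) * ?e"
      by (intro mult_left_mono) auto
    moreover have "real (card (?B \<rho>)) \<le> real (card ?R) * exp ((\<theta> + \<theta>\<^sup>2) * p - \<theta> * (k / 2 + \<Delta> / 2))"
      unfolding p_def k_def by (rule card_row_margin_sets_tail[OF F s \<theta>])
    ultimately show "real (card (?B \<rho>)) \<le> real (card ?R) * ?e"
      by linarith
  qed
  also have "\<dots> = real (m + n + 1) ^ (m + n) * (real (card ?R) * ?e)"
    by (simp add: card_PiE card_Plus)
  finally show ?thesis .
qed

text \<open>The tilt \<open>\<theta> = m powr (\<epsilon> - 1/4)\<close> makes \<open>\<theta> * m powr (7/4 + \<epsilon>)\<close> and \<open>\<theta>\<^sup>2 * m\<^sup>2\<close> both equal to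
  \<open>m powr (3/2 + 2 * \<epsilon>)\<close>, which also dominates the logarithmic cost of repairing the columns.\<close>

lemma small_determining_rare:
  fixes m n :: nat and s t :: "nat \<Rightarrow> nat" and \<epsilon> K c l :: real
  defines "l \<equiv> (\<Sum>i<m. real (s i)) / (real m * real n)"
  assumes \<epsilon>: "0 < \<epsilon>" "\<epsilon> \<le> 1 / 4" and K: "0 \<le> K" and n: "0 < n" "n \<le> m"
    and st: "(\<Sum>i<m. s i) = (\<Sum>j<n. t j)"
    and rows: "\<And>i. i < m \<Longrightarrow> \<bar>real (s i) - l * n\<bar> \<le> K * real n powr (1/2 + \<epsilon>)"
    and cols: "\<And>j. j < n \<Longrightarrow> \<bar>real (t j) - l * m\<bar> \<le> K * real m powr (1/2 + \<epsilon>)"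
    and l: "c \<le> l" "l \<le> 1 / 2"
    and e1: "(6 + 4 * K) * real n powr (\<epsilon> - 1/2) < c / 2"
    and e2: "ln 2 + 2 * real m * ln (2 * real m + 1) \<le> real m powr (3/2 + 2 * \<epsilon>)"
    and e3: "ln ((real m)\<^sup>2 + 1) \<le> real m powr \<epsilon>"
  shows "margin_sets m n s t \<noteq> {}"
    and "real (card (small_determining m n s t ((6 * K + 30) * real m powr (7/4 + \<epsilon>))))
      \<le> exp (- (real m powr (3/2 + 2 * \<epsilon>))) * real (card (margin_sets m n s t))"
proof -
  define x y where "x = real m" and "y = real n"
  have xy: "1 \<le> y" "y \<le> x"
    using n by (auto simp: x_def y_def)
  hence x: "1 \<le> x" "0 < x" "0 < y" by linarith+
  define \<alpha> \<beta> w where "\<alpha> = x powr (\<epsilon> - 1/2)" and "\<beta> = y powr (\<epsilon> - 1/2)"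
    and "w = x powr (3/2 + 2 * \<epsilon>)"
  have \<alpha>\<beta>: "0 \<le> \<alpha>" "\<alpha> \<le> \<beta>" "0 \<le> \<beta>"
    using xy \<epsilon> by (auto simp: \<alpha>_def \<beta>_def intro: powr_mono2')
  have pow: "x powr (1/2 + \<epsilon>) = x * \<alpha>" "y powr (1/2 + \<epsilon>) = y * \<beta>"
    using x by (simp_all add: \<alpha>_def \<beta>_def powr_mult_base)
  \<comment> \<open>The second inequality follows from the first, since
    \<open>c \<le> l \<le> 1 / 2\<close>.\<close>
  have c: "(6 + 4 * K) * \<beta> < c / 2" "(6 + 4 * K) * \<beta> < 1 / 4"
    using e1 l by (auto simp: \<beta>_def y_def)
  have K\<beta>: "0 \<le> K * \<beta>" "K * \<alpha> \<le> K * \<beta>"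
    using K \<alpha>\<beta> by (auto intro: mult_left_mono)
  have K\<beta>1: "K * \<beta> \<le> 1 / 4"
    using c(2) K\<beta> \<alpha>\<beta> by (simp add: algebra_simps)
  have rows': "\<bar>real (s i) - l * y\<bar> \<le> K * \<beta> * y" if "i < m" for i
    using rows[OF that] pow(2) by (simp add: y_def mult_ac)
  have cols': "\<bar>real (t j) - l * x\<bar> \<le> K * \<alpha> * x" if "j < n" for j
    using cols[OF that] pow(1) by (simp add: x_def mult_ac)
  have p: "real (s i) / real n \<le> 1 / 2 + K * \<beta>" if "i < m" for i
  proof -
    have "real (s i) \<le> (l + K * \<beta>) * y"
      using rows'[OF that] by (simp add: algebra_simps)
    hence "real (s i) / y \<le> l + K * \<beta>"
      using x by (simp add: divide_le_eq)
    thus ?thesis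
      using l by (simp add: y_def)
  qed
  have sn: "s i \<le> n" if "i < m" for i
  proof -
    have "real (s i) / real n \<le> 1"
      using p[OF that] K\<beta>1 by simp
    thus ?thesis
      using n by (simp add: divide_le_eq)
  qed
  \<comment> \<open>These are common bounds for the column and row sums, and a budget for the column
    deviations: in \<open>L\<close>, the 6 covers the random fluctuation, as
    \<open>sqrt x \<le> x * \<alpha>\<close>, and the \<open>K\<close> covers the deviation of
    \<open>t\<close> from its mean.\<close>
  define a a' b L where "a = x * (l - K * \<alpha>)" and "a' = x * (l + K * \<alpha>)"
    and "b = y * (l + K * \<beta>)" and "L = (6 + K) * y * x * \<alpha>"
  have c0: "0 \<le> c"
  proof -
    have "0 \<le> (6 + 4 * K) * \<beta>"
      using K \<alpha>\<beta> by (intro mult_nonneg_nonneg) auto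
    thus ?thesis
      using c(1) by linarith
  qed
  have \<tau>: "(\<Sum>i<m. real (s i)) / real n = l * x"
    using x by (simp add: l_def x_def)
  have lower: "real (card (row_margin_sets m n s)) / 2
    \<le> real (card (margin_sets m n s t)) * exp (2 * L * ln (real (m * n + 1)))"
  proof (rule card_margin_sets_ge[where a = a and a' = a' and b = b])
    show "a \<le> real (t j)" "real (t j) \<le> a'" if "j < n" for j
      using cols'[OF that] by (auto simp: a_def a'_def algebra_simps)
    show "real (s i) \<le> b" if "i < m" for i
      using rows'[OF that] by (auto simp: b_def algebra_simps)
    show "0 \<le> b"
      using l c0 K\<beta> x by (auto simp: b_def)
    have "sqrt x = x powr (1/2)"
      using x by (simp add: powr_half_sqrt)
    also have "\<dots> \<le> x powr (1/2 + \<epsilon>)"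
      using x \<epsilon> by (intro powr_mono) auto
    finally have sq: "sqrt x \<le> x * \<alpha>"
      by (simp add: pow)
    have "(\<Sum>j<n. \<bar>l * x - real (t j)\<bar>) \<le> (\<Sum>j<n. K * \<alpha> * x)"
      using cols' by (intro sum_mono) (auto simp: abs_minus_commute)
    moreover have "6 * y * sqrt x \<le> 6 * y * (x * \<alpha>)"
      using sq x by (intro mult_left_mono) auto
    ultimately show "6 * real n * sqrt (real m) + (\<Sum>j<n. \<bar>(\<Sum>i<m. real (s i)) / real n - real (t j)\<bar>) \<le> L"
      unfolding \<tau> by (simp add: L_def x_def[symmetric] y_def[symmetric] algebra_simps)
    \<comment> \<open>Divided by \<open>x * y\<close>, the condition for repairing says that the
      square of \<open>l\<close> plus error terms stays below \<open>l\<close>. The bound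
      \<open>l \<le> 1 / 2\<close> leaves room for \<open>l / 2\<close>, and \<open>e1\<close> keeps
      the errors smaller than that.\<close>
    have "(l + K * \<alpha>) * (l + K * \<beta>) \<le> (l + K * \<beta>) * (l + K * \<beta>)"
      using K\<beta> l c0 by (intro mult_right_mono) auto
    also have "\<dots> = l * l + 2 * l * (K * \<beta>) + (K * \<beta>) * (K * \<beta>)"
      by (simp add: algebra_simps)
    also have "\<dots> \<le> (1 / 2) * l + 1 * (K * \<beta>) + (1 / 4) * (K * \<beta>)"
      using l c0 K\<beta> K\<beta>1 by (intro add_mono mult_right_mono) auto
    finally have "(l + K * \<alpha>) * (l + K * \<beta>) \<le> l / 2 + 2 * (K * \<beta>)"
      using K\<beta> by simp
    moreover have "(6 + K) * \<alpha> \<le> (6 + K) * \<beta>"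
      using K \<alpha>\<beta> by (intro mult_left_mono) auto
    hence "(6 + K) * \<alpha> \<le> 6 * \<beta> + K * \<beta>"
      by (simp add: algebra_simps)
    moreover have "6 * \<beta> + 4 * (K * \<beta>) < l / 2"
      using c(1) l by (simp add: algebra_simps)
    ultimately have "(l + K * \<alpha>) * (l + K * \<beta>) + (6 + K) * \<alpha> < l - K * \<alpha>"
      using K\<beta> by linarith
    hence "(x * y) * ((l + K * \<alpha>) * (l + K * \<beta>) + (6 + K) * \<alpha>) < (x * y) * (l - K * \<alpha>)"
      using x by (intro mult_strict_left_mono) auto
    thus "a' * b + L < real n * a"
      by (simp add: a_def a'_def b_def L_def y_def[symmetric] algebra_simps)
  qed (use n sn st in auto)
  have "0 < card (row_margin_sets m n s)"
    using sn by (auto simp: card_row_margin_sets intro!: prod_pos)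
  hence "card (margin_sets m n s t) \<noteq> 0"
    using lower by (intro notI) simp
  thus "margin_sets m n s t \<noteq> {}"
    by auto
  define \<theta> where "\<theta> = x powr (\<epsilon> - 1/4)"
  have \<theta>: "0 \<le> \<theta>" "\<theta> \<le> 1"
  proof -
    have "x powr (\<epsilon> - 1/4) \<le> x powr 0"
      using x \<epsilon> by (intro powr_mono) auto
    thus "\<theta> \<le> 1"
      using x by (simp add: \<theta>_def)
  qed (simp add: \<theta>_def)
  \<comment> \<open>The constant is a budget in units of \<open>w\<close>: the gain
    \<open>3 * K + 15\<close> pays \<open>K + 1\<close> for the mean and the quadratic term, 1 for
    the number of ranks and \<open>12 + 2 * K\<close> for the repair, and leaves 1 over.\<close>
  let ?\<Delta> = "(6 * K + 30) * x powr (7/4 + \<epsilon>)"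
  have \<theta>\<Delta>: "\<theta> * ?\<Delta> / 2 = (3 * K + 15) * w"
  proof -
    have "\<theta> * x powr (7/4 + \<epsilon>) = w"
      by (simp add: \<theta>_def w_def flip: powr_add)
    moreover have "\<theta> * ?\<Delta> / 2 = (3 * K + 15) * (\<theta> * x powr (7/4 + \<epsilon>))"
      by (simp add: algebra_simps)
    ultimately show ?thesis
      by simp
  qed
  have \<theta>2: "\<theta>\<^sup>2 * (x * y) \<le> w"
  proof -
    have "\<theta>\<^sup>2 * (x * y) \<le> \<theta>\<^sup>2 * (x * x)"
      using xy x by (intro mult_left_mono) auto
    also have "\<dots> = \<theta> * \<theta> * (x powr 1 * x powr 1)"
      using x by (simp add: power2_eq_square)
    also have "\<dots> = w"
      unfolding \<theta>_def w_def powr_add[symmetric] by (rule arg_cong[of _ _ "(powr) x"]) simp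
    finally show ?thesis .
  qed
  \<comment> \<open>The row deviations contribute at most
    \<open>K * x powr (5/4 + 2 * \<epsilon>)\<close>, which is of lower order than
    \<open>w\<close>.\<close>
  have \<theta>\<eta>: "\<theta> * (K * \<beta>) * (x * y) \<le> K * w"
  proof -
    have "\<beta> * y \<le> x * \<alpha>"
      using powr_mono2[of "1/2 + \<epsilon>" y x] xy x \<epsilon> pow by (simp add: mult_ac)
    hence "\<theta> * (x * (\<beta> * y)) \<le> \<theta> * (x * (x * \<alpha>))"
      using \<theta> x by (intro mult_left_mono) auto
    also have "\<dots> = x powr (\<epsilon> - 1/4) * (x powr 1 * (x powr 1 * x powr (\<epsilon> - 1/2)))"
      using x by (simp add: \<theta>_def \<alpha>_def)
    also have "\<dots> = x powr (5/4 + 2 * \<epsilon>)"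
      unfolding powr_add[symmetric] by (rule arg_cong[of _ _ "(powr) x"]) simp
    also have "\<dots> \<le> w"
      unfolding w_def using x by (intro powr_mono) auto
    finally have "K * (\<theta> * (x * (\<beta> * y))) \<le> K * w"
      using K by (rule mult_left_mono)
    thus ?thesis
      by (simp add: mult_ac)
  qed
  have upper: "real (card (small_determining m n s t ?\<Delta>))
    \<le> real (m + n + 1) ^ (m + n) * (real (card (row_margin_sets m n s)) * exp ((K + 1) * w - (3 * K + 15) * w))"
  proof -
    have "(\<theta> * (K * \<beta>) + \<theta>\<^sup>2) * (real m * real n) - \<theta> * ?\<Delta> / 2 \<le> (K + 1) * w - (3 * K + 15) * w"
      using \<theta>2 \<theta>\<eta> unfolding \<theta>\<Delta> x_def[symmetric] y_def[symmetric] by (simp add: algebra_simps)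
    hence "real (m + n + 1) ^ (m + n) * (real (card (row_margin_sets m n s)) *
        exp ((\<theta> * (K * \<beta>) + \<theta>\<^sup>2) * (real m * real n) - \<theta> * ?\<Delta> / 2))
      \<le> real (m + n + 1) ^ (m + n) * (real (card (row_margin_sets m n s)) * exp ((K + 1) * w - (3 * K + 15) * w))"
      by (intro mult_left_mono) auto
    moreover have "real (card (small_determining m n s t ?\<Delta>))
      \<le> real (m + n + 1) ^ (m + n) * (real (card (row_margin_sets m n s)) *
        exp ((\<theta> * (K * \<beta>) + \<theta>\<^sup>2) * (real m * real n) - \<theta> * ?\<Delta> / 2))"
      by (rule card_small_determining_le) (use sn p K\<beta> \<theta> in auto)
    ultimately show ?thesis
      by linarith
  qed
  \<comment> \<open>The factor 2 makes up for the halving in \<open>lower\<close>.\<close>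
  have ranks: "real (m + n + 1) ^ (m + n) * 2 \<le> exp w"
  proof -
    have pos: "0 < x + y + 1"
      using x by linarith
    have "real (m + n + 1) ^ (m + n) * 2 = exp (real (m + n) * ln (x + y + 1) + ln 2)"
      using exp_ln[OF pos] unfolding exp_add exp_of_nat_mult by (simp add: x_def y_def add_ac)
    also have "real (m + n) * ln (x + y + 1) \<le> (2 * x) * ln (2 * x + 1)"
      using xy x by (intro mult_mono) (auto simp: x_def y_def)
    hence "exp (real (m + n) * ln (x + y + 1) + ln 2) \<le> exp w"
      using e2 by (simp add: w_def x_def)
    finally show ?thesis .
  qed
  \<comment> \<open>\<open>L\<close> is at most of order \<open>x powr (3/2 + \<epsilon>)\<close>;
    the remaining factor \<open>x powr \<epsilon>\<close> in \<open>w\<close> pays for the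
    logarithm.\<close>
  have ball: "2 * L * ln (real (m * n + 1)) \<le> (12 + 2 * K) * w"
  proof -
    have "x * y \<le> x * x"
      using xy x by (intro mult_left_mono) auto
    hence "ln (x * y + 1) \<le> ln (x\<^sup>2 + 1)"
      using x by (intro ln_mono) (auto simp: power2_eq_square add_pos_pos)
    also have "\<dots> \<le> x powr \<epsilon>"
      using e3 by (simp add: x_def)
    finally have "ln (x * y + 1) \<le> x powr \<epsilon>" .
    moreover have "0 \<le> ln (x * y + 1)"
      using x by (intro ln_ge_zero) auto
    ultimately have "(y * (x * \<alpha>)) * ln (x * y + 1) \<le> (x * (x * \<alpha>)) * x powr \<epsilon>"
      using xy x \<alpha>\<beta> by (intro mult_mono) auto
    also have "\<dots> = x powr 1 * (x powr 1 * x powr (\<epsilon> - 1/2)) * x powr \<epsilon>"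
      using x by (simp add: \<alpha>_def)
    also have "\<dots> = w"
      unfolding w_def powr_add[symmetric] by (rule arg_cong[of _ _ "(powr) x"]) simp
    finally have "(12 + 2 * K) * ((y * (x * \<alpha>)) * ln (x * y + 1)) \<le> (12 + 2 * K) * w"
      using K by (intro mult_left_mono) auto
    thus ?thesis
      by (simp add: L_def x_def[symmetric] y_def[symmetric] algebra_simps)
  qed
  let ?A = "real (card (margin_sets m n s t))" and ?R = "real (card (row_margin_sets m n s))"
  have "?R / 2 \<le> ?A * exp ((12 + 2 * K) * w)"
    using lower ball by (meson exp_le_cancel_iff mult_left_mono of_nat_0_le_iff order_trans)
  hence R: "?R \<le> 2 * (?A * exp ((12 + 2 * K) * w))"
    by simp
  have "real (card (small_determining m n s t ?\<Delta>))
      \<le> real (m + n + 1) ^ (m + n) * (?R * exp ((K + 1) * w - (3 * K + 15) * w))"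
    by (rule upper)
  also have "\<dots> \<le> real (m + n + 1) ^ (m + n) *
      (2 * (?A * exp ((12 + 2 * K) * w)) * exp ((K + 1) * w - (3 * K + 15) * w))"
    using R by (intro mult_left_mono mult_right_mono) auto
  also have "\<dots> = (real (m + n + 1) ^ (m + n) * 2) * (?A * exp ((12 + 2 * K) * w + ((K + 1) * w - (3 * K + 15) * w)))"
    by (simp add: exp_add)
  also have "\<dots> \<le> exp w * (?A * exp ((12 + 2 * K) * w + ((K + 1) * w - (3 * K + 15) * w)))"
    using ranks by (intro mult_right_mono) auto
  also have "\<dots> = exp (w + ((12 + 2 * K) * w + ((K + 1) * w - (3 * K + 15) * w))) * ?A"
    by (simp add: exp_add)
  also have "w + ((12 + 2 * K) * w + ((K + 1) * w - (3 * K + 15) * w)) = - w"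
    by (simp add: algebra_simps)
  finally show "real (card (small_determining m n s t ((6 * K + 30) * real m powr (7/4 + \<epsilon>))))
      \<le> exp (- (real m powr (3/2 + 2 * \<epsilon>))) * ?A"
    unfolding w_def x_def .
qed

section \<open>From sets of cells back to matrices\<close>

definition ones_cells :: "nat mat \<Rightarrow> (nat \<times> nat) set" where
  "ones_cells M = {(i, j). i < dim_row M \<and> j < dim_col M \<and> M $$ (i, j) = 1}"

lemma bij_betw_ones_cells:
  "bij_betw ones_cells (binary_matrices m n s t) (margin_sets m n s t)"
proof (rule bij_betw_byWitness[where f' = "\<lambda>X. mat m n (\<lambda>c. if c \<in> X then 1 else 0)"])
  show "\<forall>M\<in>binary_matrices m n s t. mat m n (\<lambda>c. if c \<in> ones_cells M then 1 else 0) = M"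
  proof
    fix M assume M: "M \<in> binary_matrices m n s t"
    hence dim: "dim_row M = m" "dim_col M = n"
      by (auto simp: binary_matrices_def)
    show "mat m n (\<lambda>c. if c \<in> ones_cells M then 1 else 0) = M"
    proof (rule eq_matI)
      fix i j assume ij: "i < dim_row M" "j < dim_col M"
      hence "M $$ (i, j) = 0 \<or> M $$ (i, j) = 1"
        using M dim by (simp add: binary_matrices_def)
      thus "mat m n (\<lambda>c. if c \<in> ones_cells M then 1 else 0) $$ (i, j) = M $$ (i, j)"
        using ij dim by (auto simp: ones_cells_def)
    qed (simp_all add: dim)
  qed
  show "\<forall>X\<in>margin_sets m n s t. ones_cells (mat m n (\<lambda>c. if c \<in> X then 1 else 0)) = X"
    by (auto simp: margin_sets_def row_margin_sets_def ones_cells_def split: if_splits)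
  show "ones_cells ` binary_matrices m n s t \<subseteq> margin_sets m n s t"
    by (auto simp: binary_matrices_def margin_sets_def row_margin_sets_def ones_cells_def)
  show "(\<lambda>X. mat m n (\<lambda>c. if c \<in> X then 1 else 0)) ` margin_sets m n s t \<subseteq> binary_matrices m n s t"
  proof (rule image_subsetI)
    fix X assume X: "X \<in> margin_sets m n s t"
    hence XR: "X \<in> row_margin_sets m n s"
      by (simp add: margin_sets_def)
    let ?M = "mat m n (\<lambda>c. if c \<in> X then 1 else (0 :: nat))"
    have "{j. j < n \<and> ?M $$ (i, j) = 1} = {j. (i, j) \<in> X}" if "i < m" for i
      using row_margin_setsD(1)[OF XR] that by (auto split: if_splits)
    moreover have "{i. i < m \<and> ?M $$ (i, j) = 1} = {i. (i, j) \<in> X}" if "j < n" for j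
      using row_margin_setsD(1)[OF XR] that by (auto split: if_splits)
    ultimately show "?M \<in> binary_matrices m n s t"
      using X row_margin_setsD(5)[OF XR] by (auto simp: binary_matrices_def margin_sets_def)
  qed
qed

text \<open>Let \<open>E\<close> be the set of empty cells of \<open>D\<close>. If a set with the
  right margins differs from \<open>ones_cells M\<close> only on \<open>E\<close>, its matrix also
  extends \<open>D\<close>, so uniqueness of \<open>M\<close> is exactly the condition on
  \<open>E\<close>.\<close>

lemma ones_cells_small_determining:
  assumes D: "defining_set m n s t D M"
    and small: "real (partial_size D) < (\<Sum>i<m. real (s i)) - \<Delta>"
  shows "ones_cells M \<in> small_determining m n s t \<Delta>"
proof -
  let ?U = "{..<m} \<times> {..<n}"
  define E where "E = {(i, j). i < m \<and> j < n \<and> D $$ (i, j) = None}"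
  have M: "M \<in> binary_matrices m n s t" and cont: "contained_in D M"
    and unique: "\<And>M'. M' \<in> binary_matrices m n s t \<Longrightarrow> contained_in D M' \<Longrightarrow> M' = M"
    using D by (auto simp: defining_set_def)
  have dimM: "dim_row M = m" "dim_col M = n"
    using M by (auto simp: binary_matrices_def)
  have dimD: "dim_row D = m" "dim_col D = n"
    using D by (auto simp: defining_set_def partial_binary_matrices_def)
  have X: "ones_cells M \<in> margin_sets m n s t"
    using bij_betw_imp_surj_on[OF bij_betw_ones_cells] M by blast
  hence XR: "ones_cells M \<in> row_margin_sets m n s"
    by (simp add: margin_sets_def)
  have E: "E \<subseteq> ?U"
    by (auto simp: E_def)
  have "{(i, j). i < dim_row D \<and> j < dim_col D \<and> D $$ (i, j) \<noteq> None} = ?U - E"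
    by (auto simp: E_def dimD)
  hence "partial_size D = card ?U - card E"
    using E by (simp add: partial_size_def card_Diff_subset finite_subset[OF E])
  moreover have "card E \<le> card ?U"
    using E by (intro card_mono) auto
  ultimately have size: "real (partial_size D) = real m * real n - real (card E)"
    by (simp add: card_cartesian_product)
  have "card (ones_cells M) = (\<Sum>i<m. s i)"
    using card_eq_sum_card_rows[OF row_margin_setsD(1)[OF XR]] row_margin_setsD(5)[OF XR] by simp
  moreover have "Y = ones_cells M" if Y: "Y \<in> margin_sets m n s t" "sym_diff (ones_cells M) Y \<subseteq> E" for Y
  proof -
    have "Y \<in> ones_cells ` binary_matrices m n s t"
      unfolding bij_betw_imp_surj_on[OF bij_betw_ones_cells] by (rule Y(1))
    then obtain M' where M': "M' \<in> binary_matrices m n s t" "ones_cells M' = Y"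
      by blast
    have dimM': "dim_row M' = m" "dim_col M' = n"
      using M' by (auto simp: binary_matrices_def)
    have "D $$ (i, j) \<in> {Some (M' $$ (i, j)), None}" if ij: "i < m" "j < n" for i j
    proof (cases "(i, j) \<in> E")
      case False
      hence "M $$ (i, j) = 1 \<longleftrightarrow> M' $$ (i, j) = 1"
        using Y(2) ij dimM dimM' unfolding M'(2)[symmetric] by (auto simp: ones_cells_def)
      moreover have "M $$ (i, j) \<in> {0, 1}" "M' $$ (i, j) \<in> {0, 1}"
        using M M'(1) ij by (auto simp: binary_matrices_def)
      ultimately have "M $$ (i, j) = M' $$ (i, j)"
        by auto
      moreover have "D $$ (i, j) \<in> {Some (M $$ (i, j)), None}"
        using cont ij dimM by (simp add: contained_in_def)
      ultimately show ?thesis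
        by simp
    qed (auto simp: E_def)
    hence "contained_in D M'"
      by (auto simp: contained_in_def dimM')
    thus ?thesis
      using unique M' by blast
  qed
  ultimately show ?thesis
    using X E small size unfolding small_determining_def by auto
qed

section \<open>Probabilities and the limit\<close>

text \<open>This is the bound for fixed dimensions with an explicit constant; asymptotics enter only
  through the three inequalities \<open>e\<close>, which hold once the dimensions are large.\<close>

lemma prob_no_small_defining_set:
  fixes m n :: nat and s t :: "nat \<Rightarrow> nat" and \<epsilon> K c l :: real
  defines "l \<equiv> ones_density m n s"
  assumes \<epsilon>: "0 < \<epsilon>" "\<epsilon> \<le> 1 / 4" and K: "0 \<le> K" and n: "0 < n" "n \<le> m"
    and st: "(\<Sum>i<m. s i) = (\<Sum>j<n. t j)"
    and rows: "\<And>i. i < m \<Longrightarrow> \<bar>real (s i) - average m s\<bar> \<le> K * real n powr (1/2 + \<epsilon>)"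
    and cols: "\<And>j. j < n \<Longrightarrow> \<bar>real (t j) - average n t\<bar> \<le> K * real m powr (1/2 + \<epsilon>)"
    and l: "c \<le> l" "l \<le> 1 / 2"
    and e: "(6 + 4 * K) * real n powr (\<epsilon> - 1/2) < c / 2"
      "ln 2 + 2 * real m * ln (2 * real m + 1) \<le> real m powr (3/2 + 2 * \<epsilon>)"
      "ln ((real m)\<^sup>2 + 1) \<le> real m powr \<epsilon>"
  shows "1 - exp (- (real m powr (3/2 + 2 * \<epsilon>)))
    \<le> measure_pmf.prob (pmf_of_set (binary_matrices m n s t))
        {M. \<not> (\<exists>D. defining_set m n s t D M \<and> real (partial_size D) <
           l * real m * real n - (6 * K + 30) * real m powr (7/4 + \<epsilon>))}"
proof -
  let ?\<Delta> = "(6 * K + 30) * real m powr (7/4 + \<epsilon>)"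
  let ?A = "binary_matrices m n s t"
  let ?S = "{M. \<exists>D. defining_set m n s t D M \<and> real (partial_size D) < l * real m * real n - ?\<Delta>}"
  have leq: "l = (\<Sum>i<m. real (s i)) / (real m * real n)"
    by (simp add: l_def ones_density_def average_def)
  have total: "l * real m * real n = (\<Sum>i<m. real (s i))"
    using n by (simp add: leq)
  have avg_s: "average m s = l * n"
    using n by (simp add: leq average_def)
  have "(\<Sum>j<n. real (t j)) = (\<Sum>i<m. real (s i))"
    using st by (simp flip: of_nat_sum)
  hence avg_t: "average n t = l * m"
    using n by (simp add: leq average_def)
  note rare = small_determining_rare[OF \<epsilon> K n st, of c, folded leq, OF _ _ l e]
  have A': "margin_sets m n s t \<noteq> {}"
    and small: "real (card (small_determining m n s t ?\<Delta>))
      \<le> exp (- (real m powr (3/2 + 2 * \<epsilon>))) * real (card (margin_sets m n s t))"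
    using rare rows cols by (simp_all add: avg_s avg_t)
  have cardA: "card ?A = card (margin_sets m n s t)"
    using bij_betw_ones_cells by (rule bij_betw_same_card)
  have finA: "finite ?A"
    using bij_betw_finite[OF bij_betw_ones_cells] by simp
  \<comment> \<open>\<open>pmf_of_set\<close> is the uniform distribution only for a finite nonempty
    set, so existence of a matrix with these margins has to be established.\<close>
  have A: "?A \<noteq> {}"
    using A' cardA finA by (metis card_0_eq card.empty finite_margin_sets)
  have "card (?A \<inter> ?S) \<le> card (small_determining m n s t ?\<Delta>)"
  proof (rule card_inj_on_le)
    show "inj_on ones_cells (?A \<inter> ?S)"
      using bij_betw_ones_cells by (rule inj_on_subset[OF bij_betw_imp_inj_on]) auto
    show "ones_cells ` (?A \<inter> ?S) \<subseteq> small_determining m n s t ?\<Delta>"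
      using ones_cells_small_determining unfolding total by blast
    show "finite (small_determining m n s t ?\<Delta>)"
      by (simp add: small_determining_def)
  qed
  hence "real (card (?A \<inter> ?S)) \<le> exp (- (real m powr (3/2 + 2 * \<epsilon>))) * real (card ?A)"
    using small unfolding cardA by linarith
  hence "measure_pmf.prob (pmf_of_set ?A) ?S \<le> exp (- (real m powr (3/2 + 2 * \<epsilon>)))"
    using A finA by (simp add: measure_pmf_of_set divide_le_eq card_gt_0_iff)
  moreover have "measure_pmf.prob (pmf_of_set ?A) (- ?S) = 1 - measure_pmf.prob (pmf_of_set ?A) ?S"
    using measure_pmf.prob_compl[of ?S "pmf_of_set ?A"] by (simp add: Compl_eq_Diff_UNIV)
  moreover have "- ?S = {M. \<not> (\<exists>D. defining_set m n s t D M \<and> real (partial_size D) <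
           l * real m * real n - ?\<Delta>)}"
    by auto
  ultimately show ?thesis
    by simp
qed

theorem theorem1p1:
  "\<exists>\<epsilon>\<^sub>0 > (0::real). \<forall>\<epsilon>. 0 < \<epsilon> \<and> \<epsilon> < \<epsilon>\<^sub>0 \<longrightarrow>
    (\<forall>(m :: nat \<Rightarrow> nat) (n :: nat \<Rightarrow> nat) (s :: nat \<Rightarrow> nat \<Rightarrow> nat) (t :: nat \<Rightarrow> nat \<Rightarrow> nat).
      filterlim m at_top sequentially \<and>
      filterlim n at_top sequentially \<and>
      (\<forall>k. n k \<le> m k) \<and>
      (\<lambda>k. real (m k)) \<in> o(\<lambda>k. real (n k) powr (1 + \<epsilon>)) \<and>
      (\<forall>k. \<forall>i<m k. 0 < s k i) \<and>
      (\<forall>k. \<forall>j<n k. 0 < t k j) \<and>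
      (\<forall>k. (\<Sum>i<m k. s k i) = (\<Sum>j<n k. t k j)) \<and>
      (\<exists>K. \<forall>k. \<forall>i<m k.
        \<bar>real (s k i) - average (m k) (s k)\<bar> \<le> K * real (n k) powr (1/2 + \<epsilon>)) \<and>
      (\<exists>K. \<forall>k. \<forall>j<n k.
        \<bar>real (t k j) - average (n k) (t k)\<bar> \<le> K * real (m k) powr (1/2 + \<epsilon>)) \<and>
      (\<forall>k. ones_density (m k) (n k) (s k) \<le> 1/2) \<and>
      (\<exists>c>0. \<forall>k. c \<le> ones_density (m k) (n k) (s k)) \<and>
      (\<forall>k. let l = ones_density (m k) (n k) (s k) in
        (1 - 2 * l)^2 / (4 * l * (1 - l)) *
          (1 + 5 * real (m k) / (6 * real (n k)) + 5 * real (n k) / (6 * real (m k)))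
        \<le> ln (real (m k)) / 3)
      \<longrightarrow>
      (\<exists>C::real.
        (\<lambda>k. measure_pmf.prob (pmf_of_set (binary_matrices (m k) (n k) (s k) (t k)))
          {M. \<not> (\<exists>D. defining_set (m k) (n k) (s k) (t k) D M \<and>
                 real (partial_size D) <
                   ones_density (m k) (n k) (s k) * real (m k) * real (n k)
                     - C * real (m k) powr (7/4 + \<epsilon>))})
        \<longlonglongrightarrow> 1))"
\<comment> \<open>Below \<open>1/4\<close> the tilt \<open>m powr (\<epsilon> - 1/4)\<close> is at
  most 1, and the exponent \<open>\<epsilon> - 1/2\<close> of the relative deviations is
  negative.\<close>
proof (rule exI[of _ "1/4"], intro conjI allI impI, goal_cases)
  case (2 \<epsilon> m n s t)
  define l where "l k = ones_density (m k) (n k) (s k)" for k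
  have \<epsilon>: "0 < \<epsilon>" "\<epsilon> \<le> 1 / 4"
    using 2(1) by auto
  from 2(2) have m: "filterlim m at_top sequentially" and n: "filterlim n at_top sequentially"
    and nm: "\<And>k. n k \<le> m k"
    and st: "\<And>k. (\<Sum>i<m k. s k i) = (\<Sum>j<n k. t k j)"
    and half: "\<And>k. l k \<le> 1 / 2"
    by (auto simp: l_def)
  from 2(2) obtain K1 where K1: "\<And>k i. i < m k \<Longrightarrow>
      \<bar>real (s k i) - average (m k) (s k)\<bar> \<le> K1 * real (n k) powr (1/2 + \<epsilon>)"
    by blast
  from 2(2) obtain K2 where K2: "\<And>k j. j < n k \<Longrightarrow>
      \<bar>real (t k j) - average (n k) (t k)\<bar> \<le> K2 * real (m k) powr (1/2 + \<epsilon>)"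
    by blast
  from 2(2) obtain c where c: "0 < c" "\<And>k. c \<le> l k"
    unfolding l_def by blast
  \<comment> \<open>Rows and columns come with separate constants of unknown sign; a single
    nonnegative one serves both.\<close>
  define K where "K = max 0 (max K1 K2)"
  have K: "0 \<le> K" "K1 \<le> K" "K2 \<le> K"
    by (auto simp: K_def)
  have rows: "\<bar>real (s k i) - average (m k) (s k)\<bar> \<le> K * real (n k) powr (1/2 + \<epsilon>)" if "i < m k" for k i
    using K1[OF that] mult_right_mono[OF K(2), of "real (n k) powr (1/2 + \<epsilon>)"] by simp
  have cols: "\<bar>real (t k j) - average (n k) (t k)\<bar> \<le> K * real (m k) powr (1/2 + \<epsilon>)" if "j < n k" for k j
    using K2[OF that] mult_right_mono[OF K(3), of "real (m k) powr (1/2 + \<epsilon>)"] by simp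
  have mr: "filterlim (\<lambda>k. real (m k)) at_top sequentially"
    and nr: "filterlim (\<lambda>k. real (n k)) at_top sequentially"
    using m n by (auto intro: filterlim_compose[OF filterlim_real_sequentially])
  have "((\<lambda>x. (6 + 4 * K) * x powr (\<epsilon> - 1/2)) \<longlongrightarrow> 0) at_top"
    using \<epsilon> by real_asymp
  from order_tendstoD(2)[OF filterlim_compose[OF this nr], of "c / 2"]
  have e1: "\<forall>\<^sub>F k in sequentially. (6 + 4 * K) * real (n k) powr (\<epsilon> - 1/2) < c / 2"
    using c(1) by simp
  have "\<forall>\<^sub>F x in at_top. ln 2 + 2 * x * ln (2 * x + 1) \<le> x powr (3/2 + 2 * \<epsilon>)"
    using \<epsilon> by real_asymp
  hence e2: "\<forall>\<^sub>F k in sequentially. ln 2 + 2 * real (m k) * ln (2 * real (m k) + 1)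
      \<le> real (m k) powr (3/2 + 2 * \<epsilon>)"
    by (rule eventually_compose_filterlim[OF _ mr])
  have "\<forall>\<^sub>F x in at_top. ln (x\<^sup>2 + 1) \<le> x powr \<epsilon>"
    using \<epsilon> by real_asymp
  hence e3: "\<forall>\<^sub>F k in sequentially. ln ((real (m k))\<^sup>2 + 1) \<le> real (m k) powr \<epsilon>"
    by (rule eventually_compose_filterlim[OF _ mr])
  have n0: "\<forall>\<^sub>F k in sequentially. 0 < n k"
    by (rule eventually_compose_filterlim[OF eventually_gt_at_top n])
  let ?P = "\<lambda>k. measure_pmf.prob (pmf_of_set (binary_matrices (m k) (n k) (s k) (t k)))
      {M. \<not> (\<exists>D. defining_set (m k) (n k) (s k) (t k) D M \<and> real (partial_size D) <
         l k * real (m k) * real (n k) - (6 * K + 30) * real (m k) powr (7/4 + \<epsilon>))}"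
  have "\<forall>\<^sub>F k in sequentially. 1 - exp (- (real (m k) powr (3/2 + 2 * \<epsilon>))) \<le> ?P k"
    using e1 e2 e3 n0
  proof eventually_elim
    case (elim k)
    show ?case
      unfolding l_def
      by (rule prob_no_small_defining_set[OF \<epsilon> K(1) elim(4) nm st rows cols
            c(2)[unfolded l_def] half[unfolded l_def] elim(1-3)])
  qed
  moreover have "((\<lambda>x. 1 - exp (- (x powr (3/2 + 2 * \<epsilon>)))) \<longlongrightarrow> 1) at_top"
    using \<epsilon> by real_asymp
  hence "(\<lambda>k. 1 - exp (- (real (m k) powr (3/2 + 2 * \<epsilon>)))) \<longlonglongrightarrow> 1"
    by (rule filterlim_compose[OF _ mr])
  ultimately have "?P \<longlonglongrightarrow> 1"
    by (intro tendsto_sandwich[of _ ?P sequentially "\<lambda>_. 1"]) auto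
  \<comment> \<open>The witness for \<open>C\<close> is \<open>6 * K + 30\<close>, which depends on
    the deviation constants but not on \<open>k\<close>.\<close>
  thus ?case
    unfolding l_def by blast
qed simp

end
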